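(* There is a subgroup $G\subset \mathrm{Diff}^1_+([0,1])$ which is $C^1$-close to the identity and isomorphic to the free group $\mathbb F_2$ on two generators.
   Context: A group $G\subset \mathrm{Diff}^1_+([0,1])$ is $C^1$-close to the identity if there is a sequence $h_n\in \mathrm{Diff}^1_+([0,1])$ such that $h_n g h_n^{-1}\to \mathrm{id}$ in the $C^1$-topology as $n\to\infty$, for every $g\in G$. *)

theory Defs
  imports "HOL-Analysis.Analysis" "HOL-Algebra.Group"
begin

text \<open>A map f : [0,1] -> [0,1] is represented by a function real => real which is
  the identity outside [0,1] (canonical representative), so that composition and
  inverse of such functions correspond to composition and inverse of the
  diffeomorphisms of [0,1].\<close>

definition C1_on_unit :: "(real \<Rightarrow> real) \<Rightarrow> bool" where
  "C1_on_unit f \<longleftrightarrow> (\<exists>f'. continuous_on {0..1} f' \<and>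
      (\<forall>x\<in>{0..1}. (f has_real_derivative f' x) (at x within {0..1})))"

definition Diff1_plus :: "(real \<Rightarrow> real) set" where
  "Diff1_plus = {f. (\<forall>x. x \<notin> {0..1} \<longrightarrow> f x = x)
      \<and> bij_betw f {0..1} {0..1}
      \<and> C1_on_unit f
      \<and> C1_on_unit (inv_into {0..1} f)
      \<and> mono_on {0..1} f}"

definition D01 :: "(real \<Rightarrow> real) \<Rightarrow> real \<Rightarrow> real" where
  "D01 f x = vector_derivative f (at x within {0..1})"

definition C1_tendsto :: "(nat \<Rightarrow> real \<Rightarrow> real) \<Rightarrow> (real \<Rightarrow> real) \<Rightarrow> bool" where
  "C1_tendsto F g \<longleftrightarrow> (\<forall>e>0. \<forall>\<^sub>F n in sequentially. \<forall>x\<in>{0..1}.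
      \<bar>F n x - g x\<bar> < e \<and> \<bar>D01 (F n) x - D01 g x\<bar> < e)"

definition subgroup_Diff1 :: "(real \<Rightarrow> real) set \<Rightarrow> bool" where
  "subgroup_Diff1 G \<longleftrightarrow> G \<subseteq> Diff1_plus \<and> id \<in> G
      \<and> (\<forall>f\<in>G. \<forall>g\<in>G. f \<circ> g \<in> G) \<and> (\<forall>f\<in>G. inv_into UNIV f \<in> G)"

definition diff_group :: "(real \<Rightarrow> real) set \<Rightarrow> (real \<Rightarrow> real) monoid" where
  "diff_group G = \<lparr>carrier = G, mult = (\<circ>), one = id\<rparr>"

definition C1_close_to_id :: "(real \<Rightarrow> real) set \<Rightarrow> bool" where
  "C1_close_to_id G \<longleftrightarrow> (\<exists>h :: nat \<Rightarrow> real \<Rightarrow> real. (\<forall>n. h n \<in> Diff1_plus) \<and>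
      (\<forall>g\<in>G. C1_tendsto (\<lambda>n. h n \<circ> g \<circ> inv_into UNIV (h n)) id))"

text \<open>Letters: (generator index, is_inverse). Elements: freely reduced words.\<close>
type_synonym letter2 = "bool \<times> bool"

definition cancels :: "letter2 \<Rightarrow> letter2 \<Rightarrow> bool" where
  "cancels x y \<longleftrightarrow> fst x = fst y \<and> snd x \<noteq> snd y"

fun red :: "letter2 list \<Rightarrow> letter2 list" where
  "red [] = []"
| "red (x # xs) = (case red xs of [] \<Rightarrow> [x]
      | y # ys \<Rightarrow> (if cancels x y then ys else x # y # ys))"

definition reduced :: "letter2 list \<Rightarrow> bool" where
  "reduced xs \<longleftrightarrow> (\<forall>i. Suc i < length xs \<longrightarrow> \<not> cancels (xs ! i) (xs ! Suc i))"

definition F2 :: "letter2 list monoid" where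
  "F2 = \<lparr>carrier = {xs. reduced xs}, mult = (\<lambda>xs ys. red (xs @ ys)), one = []\<rparr>"

end

theory Submission
  imports Defs "HOL-Library.List_Lenlexorder"
begin

text \<open>
  On integer vectors let the generator a add v_{j-1} to v_j for all odd j, and let b do so for all
  even j > 0. These unipotent maps preserve the lexicographic order, and a reduced word with k
  syllables moves some basis vector once the dimension exceeds k + 1, so the free group acts
  faithfully by order automorphisms on the integer lists (ordered by length, then
  lexicographically).

  Blow up every list w to an interval of length l(w), with total length 1, and let the group permute
  these intervals using Yoccoz' equivariant family of diffeomorphisms between intervals. The result
  is of class C^1 as soon as l(g w) / l(w) tends to 1 as w leaves finite sets, and it is C^1-close to
  the identity when this ratio is uniformly close to 1. In dimension d we take
  l(v) = (c / N(v))^d with N(v) = B + v_0^(2^d) + ... + v_(d-1)^2. Since the exponents are halved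
  from one coordinate to the next, N(g v) / N(v) tends to 1 as N(v) tends to infinity, hence is
  uniformly near 1 if B is large. Changing B for finitely many d does not affect l at infinity up to
  a factor tending to 1, so it amounts to a C^1 conjugacy; the conjugacies h_n let B tend to
  infinity. The empty list is fixed by the group, and its length absorbs the normalisation.
\<close>

section \<open>Yoccoz' equivariant family\<close>

definition yoccoz :: "real \<Rightarrow> real \<Rightarrow> real" where
  "yoccoz a t = a / pi * (arctan (a * t) + pi / 2)"

text \<open>
  The maps \<open>yoccoz a\<close> parametrise the intervals (0, a) by the real line, so the transition maps
  (0, a) to (0, b) compose; \<open>stretch a b\<close> is the derivative of that transition map minus 1. It
  vanishes at both end points, which is why it extends continuously by 0.
\<close>

definition stretch :: "real \<Rightarrow> real \<Rightarrow> real \<Rightarrow> real" where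
  "stretch a b u =
     (if u \<in> {0..a} then 1 / ((cos (pi * u / a))\<^sup>2 + (a / b)\<^sup>2 * (sin (pi * u / a))\<^sup>2) - 1 else 0)"

lemma yoccoz_bounds:
  assumes "a > 0"
  shows "0 < yoccoz a t" "yoccoz a t < a"
proof -
  have "- (pi / 2) < arctan (a * t)" "arctan (a * t) < pi / 2"
    using arctan_lbound[of "a * t"] arctan_ubound[of "a * t"] by simp_all
  then have "0 < (arctan (a * t) + pi / 2) / pi" "(arctan (a * t) + pi / 2) / pi < 1"
    by (simp_all add: divide_simps)
  then have "0 < a * ((arctan (a * t) + pi / 2) / pi)" "a * ((arctan (a * t) + pi / 2) / pi) < a * 1"
    using assms by (blast intro: mult_pos_pos mult_strict_left_mono)+
  then show "0 < yoccoz a t" "yoccoz a t < a"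
    by (simp_all add: yoccoz_def)
qed

lemma yoccoz_surj:
  assumes "0 < u" "u < a"
  obtains t where "yoccoz a t = u"
proof
  have "arctan (tan (pi * u / a - pi / 2)) = pi * u / a - pi / 2"
    using assms by (intro arctan_tan) (auto simp: field_simps)
  then show "yoccoz a (tan (pi * u / a - pi / 2) / a) = u"
    using assms by (auto simp: yoccoz_def field_simps)
qed

lemma yoccoz_deriv:
  "(yoccoz a has_real_derivative a\<^sup>2 / pi / (1 + (a * t)\<^sup>2)) (at t)"
proof -
  have "((\<lambda>t. a / pi * (arctan (a * t) + pi / 2)) has_real_derivative
      a / pi * (a * inverse (1 + (a * t)\<^sup>2) + 0)) (at t)"
    by (auto intro!: derivative_eq_intros)
  then show ?thesis
    by (simp add: yoccoz_def[abs_def] power2_eq_square inverse_eq_divide)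
qed

lemma yoccoz_at_bot: "a > 0 \<Longrightarrow> (yoccoz a \<longlongrightarrow> 0) at_bot"
proof -
  assume a: "a > 0"
  have "filterlim (\<lambda>t. a * t) at_bot at_bot"
    by (rule filterlim_tendsto_pos_mult_at_bot[OF tendsto_const a filterlim_ident])
  then have "((\<lambda>t. arctan (a * t)) \<longlongrightarrow> - (pi / 2)) at_bot"
    by (rule filterlim_compose[OF tendsto_arctan_at_bot])
  then have "((\<lambda>t. a / pi * (arctan (a * t) + pi / 2)) \<longlongrightarrow> a / pi * (- (pi / 2) + pi / 2)) at_bot"
    by (intro tendsto_intros)
  then show ?thesis
    by (simp add: yoccoz_def[abs_def])
qed

lemma yoccoz_at_top: "a > 0 \<Longrightarrow> (yoccoz a \<longlongrightarrow> a) at_top"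
proof -
  assume a: "a > 0"
  have "filterlim (\<lambda>t. a * t) at_top at_top"
    by (rule filterlim_tendsto_pos_mult_at_top[OF tendsto_const a filterlim_ident])
  then have "((\<lambda>t. arctan (a * t)) \<longlongrightarrow> pi / 2) at_top"
    by (rule filterlim_compose[OF tendsto_arctan_at_top])
  then have "((\<lambda>t. a / pi * (arctan (a * t) + pi / 2)) \<longlongrightarrow> a / pi * (pi / 2 + pi / 2)) at_top"
    by (intro tendsto_intros)
  then show ?thesis
    by (simp add: yoccoz_def[abs_def])
qed

lemma convex_squares_pos:
  fixes r x :: real
  assumes "r > 0"
  shows "(cos x)\<^sup>2 + r\<^sup>2 * (sin x)\<^sup>2 > 0"
proof (cases "cos x = 0")
  case True
  then have "(sin x)\<^sup>2 = 1"
    using sin_cos_squared_add[of x] by simp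
  then show ?thesis using True assms by simp
next
  case False
  then show ?thesis by (simp add: add_pos_nonneg)
qed

text \<open>Keeps the derivative \<open>1 + slope\<close> of a blow-up positive, hence the map
  increasing.\<close>

lemma stretch_gt:
  assumes "a > 0" "b > 0"
  shows "stretch a b u > -1"
  using convex_squares_pos[of "a / b"] assms by (auto simp: stretch_def)

text \<open>With \<open>q\<close> the squared length ratio and \<open>s\<close> the squared sine,
  the stretch is \<open>(q - 1) * (s / (q * (1 - s) + s))\<close>, and the fraction lies in [0,1].
  So the length ratio alone controls the derivative, wherever \<open>u\<close> lies.\<close>

lemma stretch_bound:
  assumes "a > 0" "b > 0" and e: "\<bar>(b / a)\<^sup>2 - 1\<bar> \<le> e"
  shows "\<bar>stretch a b u\<bar> \<le> e"
proof (cases "u \<in> {0..a}")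
  case True
  define s where "s = (sin (pi * u / a))\<^sup>2"
  define q where "q = (b / a)\<^sup>2"
  have q: "q > 0" "(a / b)\<^sup>2 = 1 / q" using assms by (auto simp: q_def field_simps)
  have s: "0 \<le> s" "s \<le> 1" "(cos (pi * u / a))\<^sup>2 = 1 - s"
    by (auto simp: s_def cos_squared_eq abs_square_le_1)
  have d: "q * (1 - s) + s > 0"
  proof (cases "s = 1")
    case False
    then show ?thesis using s q by (intro add_pos_nonneg mult_pos_pos) auto
  qed simp
  have "stretch a b u = 1 / (1 - s + 1 / q * s) - 1"
    using True by (simp add: stretch_def s(3) q(2) flip: s_def)
  also have "1 - s + 1 / q * s = (q * (1 - s) + s) / q"
    using q by (simp add: field_simps)
  also have "1 / \<dots> - 1 = (q - 1) * s / (q * (1 - s) + s)"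
    using d q by (simp add: field_simps)
  finally have eq: "stretch a b u = (q - 1) * (s / (q * (1 - s) + s))"
    by simp
  have "s / (q * (1 - s) + s) \<le> 1" "s / (q * (1 - s) + s) \<ge> 0"
    using d s q by (auto simp: field_simps)
  then have "\<bar>stretch a b u\<bar> \<le> \<bar>q - 1\<bar> * 1"
    unfolding eq abs_mult by (intro mult_left_mono) (simp_all only: abs_of_nonneg abs_ge_zero)
  then show ?thesis using e by (simp add: q_def)
next
  case False
  then show ?thesis using assms by (auto simp: stretch_def)
qed

lemma stretch_refl [simp]: "a > 0 \<Longrightarrow> stretch a a u = 0"
  by (simp add: stretch_def)

lemma stretch_zero: "a > 0 \<Longrightarrow> u \<le> 0 \<or> u \<ge> a \<Longrightarrow> stretch a b u = 0"
  by (auto simp: stretch_def)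

lemma stretch_continuous:
  assumes "a > 0" "b > 0"
  shows "continuous_on UNIV (stretch a b)"
proof -
  let ?f = "\<lambda>u. 1 / ((cos (pi * u / a))\<^sup>2 + (a / b)\<^sup>2 * (sin (pi * u / a))\<^sup>2) - 1"
  have "continuous_on S ?f" for S
    using convex_squares_pos[of "a / b"] assms
    by (intro continuous_intros) (auto simp: less_imp_neq[symmetric])
  then have "continuous_on ({0..a} \<union> ({..0} \<union> {a..})) (\<lambda>u. if u \<in> {0..a} then ?f u else 0)"
    using assms by (intro continuous_on_If) auto
  moreover have "{0..a} \<union> ({..0} \<union> {a..}) = UNIV"
    by auto
  ultimately show ?thesis
    by (simp add: stretch_def[abs_def])
qed

text \<open>The chain rule for the transition map from the parametrisation \<open>yoccoz a\<close>
  to \<open>yoccoz b\<close>, with derivative \<open>1 + stretch a b\<close>. It identifies the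
  integral of \<open>stretch\<close> with the displacement of that map.\<close>

lemma stretch_yoccoz:
  assumes "a > 0" "b > 0"
  shows "stretch a b (yoccoz a t) * (a\<^sup>2 / pi / (1 + (a * t)\<^sup>2)) =
    b\<^sup>2 / pi / (1 + (b * t)\<^sup>2) - a\<^sup>2 / pi / (1 + (a * t)\<^sup>2)"
proof -
  define x where "x = a * t"
  have x1: "1 + x\<^sup>2 > 0" "1 + (b * t)\<^sup>2 > 0" by (auto intro: add_pos_nonneg)
  \<comment> \<open>The angle is a quarter turn past \<open>arctan x\<close>, so sine and cosine
    swap roles and both squares become rational in \<open>x\<close>.\<close>
  have ang: "pi * yoccoz a t / a = arctan x + pi / 2"
    using assms by (simp add: yoccoz_def x_def field_simps)
  have c: "(cos (arctan x))\<^sup>2 = 1 / (1 + x\<^sup>2)" "(sin (arctan x))\<^sup>2 = x\<^sup>2 / (1 + x\<^sup>2)"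
    by (auto simp: cos_arctan sin_arctan power_divide)
  have "stretch a b (yoccoz a t) = 1 / (x\<^sup>2 / (1 + x\<^sup>2) + (a / b)\<^sup>2 * (1 / (1 + x\<^sup>2))) - 1"
    using yoccoz_bounds[OF assms(1), of t]
    by (simp add: stretch_def ang sin_add cos_add c)
  also have "x\<^sup>2 / (1 + x\<^sup>2) + (a / b)\<^sup>2 * (1 / (1 + x\<^sup>2)) = (a / b)\<^sup>2 * (1 + (b * t)\<^sup>2) / (1 + x\<^sup>2)"
  proof -
    have "x\<^sup>2 = (a / b)\<^sup>2 * (b * t)\<^sup>2"
      using assms by (simp add: x_def power_mult_distrib power_divide)
    then show ?thesis
      by (simp only: times_divide_eq_right mult_1_right distrib_left add_divide_distrib)
  qed
  finally have "stretch a b (yoccoz a t) + 1 = (1 + x\<^sup>2) * b\<^sup>2 / (a\<^sup>2 * (1 + (b * t)\<^sup>2))"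
    using x1 assms by (simp add: field_simps)
  then have "(stretch a b (yoccoz a t) + 1) * (a\<^sup>2 / pi / (1 + x\<^sup>2)) = b\<^sup>2 / pi / (1 + (b * t)\<^sup>2)"
    using x1 assms by simp
  then show ?thesis
    unfolding x_def distrib_right by linarith
qed

text \<open>The displacement caused by replacing an interval of length \<open>a\<close> that starts
  at \<open>p\<close> by one of length \<open>b\<close>. Starting from the integral gives the
  derivative on all of [0,1] at once, also at the end points of the interval.\<close>

definition drift :: "real \<Rightarrow> real \<Rightarrow> real \<Rightarrow> real \<Rightarrow> real" where
  "drift a b p x = integral {0..x} (\<lambda>y. stretch a b (y - p))"

lemma drift_deriv:
  assumes "a > 0" "b > 0" "x \<in> {0..1}"
  shows "(drift a b p has_real_derivative stretch a b (x - p)) (at x within {0..1})"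
proof -
  have "continuous_on {0..1} (\<lambda>y. stretch a b (y - p))"
    by (rule continuous_on_compose2[OF stretch_continuous[OF assms(1,2)]]) (auto intro: continuous_intros)
  from integral_has_real_derivative[OF this assms(3)] show ?thesis
    by (simp add: drift_def[abs_def])
qed

lemma drift_refl [simp]: "a > 0 \<Longrightarrow> drift a a p x = 0"
  by (simp add: drift_def)

lemma drift_before:
  assumes "a > 0" "x \<le> p"
  shows "drift a b p x = 0"
proof -
  have "drift a b p x = integral {0..x} (\<lambda>y. 0)"
    unfolding drift_def using assms by (intro integral_cong) (auto simp: stretch_zero)
  then show ?thesis by simp
qed

lemma drift_continuous:
  assumes "a > 0" "b > 0"
  shows "continuous_on {0..1} (drift a b p)"
  using drift_deriv[OF assms] by (rule DERIV_continuous_on)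

text \<open>As functions of \<open>t\<close> both sides have the same derivative by
  \<open>stretch_yoccoz\<close>, so they differ by a constant; letting \<open>t\<close> tend to
  minus infinity shows that it is 0.\<close>

lemma drift_inside:
  assumes "a > 0" "b > 0" "p \<ge> 0" "p + a \<le> 1"
  shows "drift a b p (p + yoccoz a t) = yoccoz b t - yoccoz a t"
proof -
  define H where "H = (\<lambda>t. drift a b p (p + yoccoz a t) - (yoccoz b t - yoccoz a t))"
  have "(H has_real_derivative 0) (at t)" for t
  proof -
    let ?x = "p + yoccoz a t"
    have x: "?x \<in> {0<..<1}"
      using yoccoz_bounds[OF assms(1), of t] assms by auto
    then have "(drift a b p has_real_derivative stretch a b (?x - p)) (at ?x within {0..1})"
      using assms by (intro drift_deriv) auto
    moreover have "at ?x within {0..1} = at ?x"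
      using x by (intro at_within_interior) auto
    ultimately have "(drift a b p has_real_derivative stretch a b (yoccoz a t)) (at ?x)"
      by simp
    then have "((\<lambda>t. drift a b p (p + yoccoz a t)) has_real_derivative
        stretch a b (yoccoz a t) * (a\<^sup>2 / pi / (1 + (a * t)\<^sup>2))) (at t)"
      by (rule DERIV_chain2) (auto intro!: derivative_eq_intros yoccoz_deriv)
    then have "(H has_real_derivative stretch a b (yoccoz a t) * (a\<^sup>2 / pi / (1 + (a * t)\<^sup>2))
        - (b\<^sup>2 / pi / (1 + (b * t)\<^sup>2) - a\<^sup>2 / pi / (1 + (a * t)\<^sup>2))) (at t)"
      unfolding H_def by (intro DERIV_diff yoccoz_deriv)
    then show ?thesis
      by (simp only: stretch_yoccoz[OF assms(1,2)] diff_self)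
  qed
  then have const: "H x = H t" for x
    using DERIV_isconst_all by blast
  have "((\<lambda>t. drift a b p (p + yoccoz a t)) \<longlongrightarrow> drift a b p (p + 0)) at_bot"
  proof (rule continuous_on_tendsto_compose[OF drift_continuous[OF assms(1,2)]])
    show "((\<lambda>t. p + yoccoz a t) \<longlongrightarrow> p + 0) at_bot"
      using yoccoz_at_bot[OF assms(1)] by (intro tendsto_intros)
    show "\<forall>\<^sub>F t in at_bot. p + yoccoz a t \<in> {0..1}"
      using yoccoz_bounds[OF assms(1)] assms
      by (intro always_eventually) (auto simp: less_imp_le add_nonneg_nonneg intro: order_trans[of _ "p + a"])
  qed (use assms in auto)
  then have "(H \<longlongrightarrow> drift a b p (p + 0) - (0 - 0)) at_bot"
    unfolding H_def using assms by (intro tendsto_intros yoccoz_at_bot)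
  moreover have "(H \<longlongrightarrow> H t) at_bot"
    by (rule tendsto_eventually, rule always_eventually) (use const in blast)
  ultimately have "H t = drift a b p (p + 0) - (0 - 0)"
    using tendsto_unique[OF trivial_limit_at_bot_linorder] by blast
  then show ?thesis
    using drift_before[OF assms(1), of p p b] by (simp add: H_def)
qed

text \<open>Letting \<open>t\<close> tend to infinity in \<open>drift_inside\<close> gives the value
  at \<open>p + a\<close>; beyond that point the integrand vanishes.\<close>

lemma drift_after:
  assumes "a > 0" "b > 0" "p \<ge> 0" "p + a \<le> x" "x \<le> 1"
  shows "drift a b p x = b - a"
proof -
  have "((\<lambda>t. drift a b p (p + yoccoz a t)) \<longlongrightarrow> drift a b p (p + a)) at_top"
  proof (rule continuous_on_tendsto_compose[OF drift_continuous[OF assms(1,2)]])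
    show "((\<lambda>t. p + yoccoz a t) \<longlongrightarrow> p + a) at_top"
      using yoccoz_at_top[OF assms(1)] by (intro tendsto_intros)
    show "\<forall>\<^sub>F t in at_top. p + yoccoz a t \<in> {0..1}"
      using yoccoz_bounds[OF assms(1)] assms
      by (intro always_eventually) (auto simp: less_imp_le add_nonneg_nonneg intro: order_trans[of _ "p + a"])
  qed (use assms in auto)
  moreover have "((\<lambda>t. drift a b p (p + yoccoz a t)) \<longlongrightarrow> b - a) at_top"
    using assms by (simp add: drift_inside yoccoz_at_top tendsto_diff)
  ultimately have eq: "drift a b p (p + a) = b - a"
    using tendsto_unique[OF trivial_limit_at_top_linorder] by blast
  have "drift a b p x = drift a b p (p + a)"
  proof (cases "x = p + a")
    case False
    have "continuous_on {0..x} (\<lambda>y. stretch a b (y - p))"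
      by (rule continuous_on_compose2[OF stretch_continuous[OF assms(1,2)]]) (auto intro: continuous_intros)
    then have "integral {0..p + a} (\<lambda>y. stretch a b (y - p)) + integral {p + a..x} (\<lambda>y. stretch a b (y - p))
        = integral {0..x} (\<lambda>y. stretch a b (y - p))"
      using assms by (intro Henstock_Kurzweil_Integration.integral_combine integrable_continuous_real) auto
    moreover have "integral {p + a..x} (\<lambda>y. stretch a b (y - p)) = integral {p + a..x} (\<lambda>y. 0)"
      using assms by (intro integral_cong) (auto simp: stretch_zero)
    ultimately show ?thesis
      by (simp add: drift_def)
  qed simp
  with eq show ?thesis by simp
qed

text \<open>A crude bound, but summable over all intervals, as \<open>drift_summable\<close>
  needs.\<close>

lemma drift_bounds:
  assumes "a > 0" "b > 0" "p \<ge> 0" "p + a \<le> 1" "x \<le> 1"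
  shows "\<bar>drift a b p x\<bar> \<le> a + b"
proof -
  consider "x \<le> p" | "x \<ge> p + a" | "p < x" "x < p + a" by linarith
  then show ?thesis
  proof cases
    case 3
    then obtain t where "yoccoz a t = x - p"
      using yoccoz_surj[of "x - p" a] by auto
    then have "drift a b p x = yoccoz b t - yoccoz a t"
      using drift_inside[OF assms(1-4), of t] by simp
    then show ?thesis
      using yoccoz_bounds[of a t] yoccoz_bounds[of b t] assms by linarith
  qed (use assms in \<open>auto simp: drift_before drift_after\<close>)
qed

section \<open>Blowing up a countable linear order\<close>

definition lengths :: "('w::{linorder,countable} \<Rightarrow> real) \<Rightarrow> bool" where
  "lengths l \<longleftrightarrow> (\<forall>w. l w > 0) \<and> (l has_sum 1) UNIV"

definition left :: "('w::{linorder,countable} \<Rightarrow> real) \<Rightarrow> 'w \<Rightarrow> real" where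
  "left l w = infsum l {..<w}"

text \<open>The real line serves as coordinate on every open interval, whatever its length; blow-ups
  preserve the coordinate \<open>t\<close>.\<close>

definition point :: "('w::{linorder,countable} \<Rightarrow> real) \<Rightarrow> 'w \<Rightarrow> real \<Rightarrow> real" where
  "point l w t = left l w + yoccoz (l w) t"

lemma lengths_pos: "lengths l \<Longrightarrow> l w > 0"
  by (simp add: lengths_def)

lemma lengths_summable: "lengths l \<Longrightarrow> l summable_on A"
  by (meson lengths_def subset_UNIV summable_on_def summable_on_subset_banach)

lemma left_nonneg: "lengths l \<Longrightarrow> 0 \<le> left l w"
  by (auto simp: left_def lengths_pos less_imp_le intro: infsum_nonneg)

lemma left_plus: "lengths l \<Longrightarrow> left l w + l w = infsum l {..w}"
proof -
  assume l: "lengths l"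
  have "{..w} = insert w {..<w}" by auto
  then show ?thesis
    using infsum_insert[OF lengths_summable[OF l], of w "{..<w}"] by (simp add: left_def)
qed

lemma left_less:
  assumes "lengths l" "w < w'"
  shows "left l w + l w \<le> left l w'"
  unfolding left_plus[OF assms(1)] unfolding left_def using assms
  by (intro infsum_mono2 lengths_summable) (auto simp: lengths_pos less_imp_le)

lemma left_plus_le_1: "lengths l \<Longrightarrow> left l w + l w \<le> 1"
proof -
  assume l: "lengths l"
  then have "infsum l {..w} \<le> infsum l UNIV"
    by (intro infsum_mono2 lengths_summable) (auto simp: lengths_pos less_imp_le)
  also have "infsum l UNIV = 1"
    using l by (auto simp: lengths_def intro: infsumI)
  finally show ?thesis using left_plus[OF l] by simp
qed

lemma left_disjoint:
  assumes "lengths l" "left l w < x" "x < left l w + l w" "left l v < x" "x < left l v + l v"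
  shows "w = v"
  using left_less[OF assms(1), of w v] left_less[OF assms(1), of v w] assms
  by (cases w v rule: linorder_cases) auto

lemma point_bounds:
  assumes "lengths l"
  shows "left l w < point l w t" "point l w t < left l w + l w"
  using yoccoz_bounds[OF lengths_pos[OF assms], of w t] by (auto simp: point_def)

lemma point_in_unit: "lengths l \<Longrightarrow> point l w t \<in> {0..1}"
  using point_bounds[of l w t] left_nonneg[of l w] left_plus_le_1[of l w] by auto

lemma point_inj:
  assumes "lengths l" "point l w t = point l v t'"
  shows "w = v"
  using left_disjoint[OF assms(1)] point_bounds[OF assms(1)] assms(2) by metis

lemma pointE:
  assumes "left l w < x" "x < left l w + l w"
  obtains t where "x = point l w t"
  using yoccoz_surj[of "x - left l w" "l w"] assms by (auto simp: point_def algebra_simps)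

definition points :: "('w::{linorder,countable} \<Rightarrow> real) \<Rightarrow> real set" where
  "points l = {point l w t |w t. True}"

text \<open>A gap missed by the points would be disjoint from all open intervals; finitely many of
  these, with total length close to 1, together with the gap would exceed the measure of [0,1].
  Density lets identities between continuous maps be checked on \<open>points\<close>.\<close>

lemma closure_points:
  assumes l: "lengths l"
  shows "closure (points l) = {0..1}"
proof
  show "closure (points l) \<subseteq> {0..1}"
    using point_in_unit[OF l] by (intro closure_minimal) (auto simp: points_def)
  show "{0..1} \<subseteq> closure (points l)"
  proof (rule ccontr)
    assume "\<not> {0..1} \<subseteq> closure (points l)"
    then obtain x where x: "x \<in> {0..1}" "x \<notin> closure (points l)" by blast
    then obtain e where e: "e > 0" "\<And>y. y \<in> points l \<Longrightarrow> \<not> dist y x < e"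
      by (auto simp: closure_approachable)
    define c where "c = max 0 (x - e)"
    define d where "d = min 1 (x + e)"
    have cd: "c < d" "0 \<le> c" "d \<le> 1" using x e by (auto simp: c_def d_def)
    have gap: "y \<notin> points l" if "c < y" "y < d" for y
      using e(2)[of y] that by (auto simp: c_def d_def dist_real_def)
    let ?I = "\<lambda>w. {left l w<..<left l w + l w}"
    have Ip: "?I w \<subseteq> points l" for w
      by (auto simp: points_def) (metis pointE)
    have "(sum l \<longlongrightarrow> 1) (finite_subsets_at_top UNIV)"
      using l by (auto simp: lengths_def has_sum_def)
    then have "\<forall>\<^sub>F W in finite_subsets_at_top UNIV. sum l W > 1 - (d - c)"
      by (rule order_tendstoD) (use cd in auto)
    then obtain W where W: "finite W" "sum l W > 1 - (d - c)"
      by (auto simp: eventually_finite_subsets_at_top)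
    have "ennreal (sum l W + (d - c)) = (\<Sum>w\<in>W. emeasure lborel (?I w)) + emeasure lborel {c<..<d}"
      using lengths_pos[OF l] cd
      by (simp add: less_imp_le sum_ennreal sum_nonneg flip: ennreal_plus)
    also have "(\<Sum>w\<in>W. emeasure lborel (?I w)) = emeasure lborel (\<Union>w\<in>W. ?I w)"
    proof (intro sum_emeasure)
      show "disjoint_family_on ?I W"
        unfolding disjoint_family_on_def using left_disjoint[OF l] by fastforce
    qed (use W in auto)
    also have "\<dots> + emeasure lborel {c<..<d} = emeasure lborel ((\<Union>w\<in>W. ?I w) \<union> {c<..<d})"
    proof (rule plus_emeasure)
      show "(\<Union>w\<in>W. ?I w) \<inter> {c<..<d} = {}"
        using Ip gap by fastforce
    qed auto
    also have "\<dots> \<le> emeasure lborel {0..1::real}"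
      using cd left_nonneg[OF l] left_plus_le_1[OF l]
      by (intro emeasure_mono) (auto intro: less_imp_le order_trans less_trans dest: le_less_trans less_le_trans, (smt (verit, best))+)
    finally show False
      using W cd by (simp del: ennreal_plus)
  qed
qed

text \<open>Passes from unordered sums over a countable type to series over the naturals, which can
  be differentiated termwise; numbers that code no element get the term 0.\<close>

lemma has_sum_sums_to_nat:
  fixes f :: "'w::countable \<Rightarrow> real"
  assumes "(f has_sum s) UNIV"
  shows "(\<lambda>i. if i \<in> range (to_nat :: 'w \<Rightarrow> nat) then f (from_nat i) else 0) sums s"
proof (rule has_sum_imp_sums)
  have "((\<lambda>i. f (from_nat i)) has_sum s) (range (to_nat :: 'w \<Rightarrow> nat))"
    using assms by (subst has_sum_reindex) (auto simp: o_def)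
  then show "((\<lambda>i. if i \<in> range (to_nat :: 'w \<Rightarrow> nat) then f (from_nat i) else 0) has_sum s) UNIV"
    by (rule has_sum_cong_neutral[THEN iffD1, rotated 3]) auto
qed

text \<open>At each point at most one term is nonzero, so the error of a partial sum is 0 or a
  single late term; uniform smallness of the terms takes the place of a Weierstrass
  majorant.\<close>

lemma uniform_limit_disjoint_supports:
  fixes f :: "nat \<Rightarrow> 'a \<Rightarrow> real"
  assumes disj: "\<And>i j x. f i x \<noteq> 0 \<Longrightarrow> f j x \<noteq> 0 \<Longrightarrow> i = j"
    and small: "\<And>e. e > 0 \<Longrightarrow> \<forall>\<^sub>F i in sequentially. \<forall>x. \<bar>f i x\<bar> < e"
    and sums: "\<And>x. x \<in> S \<Longrightarrow> (\<lambda>i. f i x) sums g x"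
  shows "uniform_limit S (\<lambda>n x. \<Sum>i<n. f i x) g sequentially"
proof (rule uniform_limitI)
  fix e :: real assume e: "e > 0"
  then obtain m where m: "\<And>i x. i \<ge> m \<Longrightarrow> \<bar>f i x\<bar> < e"
    using small[OF e] by (auto simp: eventually_sequentially)
  have "dist (\<Sum>i<n. f i x) (g x) < e" if n: "n \<ge> m" and x: "x \<in> S" for n x
  proof (cases "\<exists>i. f i x \<noteq> 0")
    case True
    then obtain k where k: "f k x \<noteq> 0" by blast
    have other: "f i x = 0" if "i \<noteq> k" for i
      using disj k that by blast
    have "(\<lambda>i. f i x) sums (\<Sum>i\<in>{k}. f i x)"
      by (rule sums_finite) (auto simp: other)
    then have g: "g x = f k x"
      using sums[OF x] sums_unique2 by fastforce
    show ?thesis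
    proof (cases "k < n")
      case True
      then have "(\<Sum>i<n. f i x) = (\<Sum>i\<in>{k}. f i x)"
        by (intro sum.mono_neutral_right) (auto simp: other)
      then show ?thesis using g e by simp
    next
      case False
      then have "(\<Sum>i<n. f i x) = 0"
        by (intro sum.neutral) (auto simp: other)
      then show ?thesis using g m[of k x] n False by (simp add: dist_real_def)
    qed
  next
    case False
    then have "(\<lambda>i. 0) sums g x" using sums[OF x] by simp
    then have "g x = 0" using sums_unique2 sums_zero by blast
    then show ?thesis using False e by simp
  qed
  then show "\<forall>\<^sub>F n in sequentially. \<forall>x\<in>S. dist (\<Sum>i<n. f i x) (g x) < e"
    by (auto simp: eventually_sequentially)
qed

section \<open>Order automorphisms whose length ratios tend to 1\<close>

definition tame :: "('w::{linorder,countable} \<Rightarrow> real) \<Rightarrow> ('w \<Rightarrow> real) \<Rightarrow> ('w \<Rightarrow> 'w) \<Rightarrow> bool" where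
  "tame l l' s \<longleftrightarrow> lengths l \<and> lengths l' \<and> strict_mono s \<and> surj s \<and>
     ((\<lambda>w. l' (s w) / l w) \<longlongrightarrow> 1) cofinite"

lemma tame_bij: "tame l l' s \<Longrightarrow> bij s"
  by (auto simp: tame_def bij_def intro: strict_mono_imp_inj_on)

lemma filterlim_inj_cofinite:
  assumes "inj s"
  shows "filterlim s cofinite cofinite"
  unfolding filterlim_iff eventually_cofinite
proof (intro allI impI)
  fix P :: "'b \<Rightarrow> bool" assume "finite {x. \<not> P x}"
  then show "finite {x. \<not> P (s x)}"
    using finite_vimageI[OF _ assms, of "{x. \<not> P x}"] by (simp add: vimage_def)
qed

lemma tame_comp:
  assumes "tame l l' s" "tame l' l'' s'"
  shows "tame l l'' (s' \<circ> s)"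
proof -
  have "filterlim s cofinite cofinite"
    by (intro filterlim_inj_cofinite bij_is_inj tame_bij[OF assms(1)])
  then have "((\<lambda>w. l'' (s' (s w)) / l' (s w)) \<longlongrightarrow> 1) cofinite"
    using assms(2) by (auto simp: tame_def intro: filterlim_compose)
  then have "((\<lambda>w. l'' (s' (s w)) / l' (s w) * (l' (s w) / l w)) \<longlongrightarrow> 1 * 1) cofinite"
    using assms(1) by (intro tendsto_mult) (auto simp: tame_def)
  moreover have "l'' (s' (s w)) / l' (s w) * (l' (s w) / l w) = l'' (s' (s w)) / l w" for w
    using assms lengths_pos[of l' "s w"] by (simp add: tame_def less_imp_neq[symmetric])
  ultimately have "((\<lambda>w. l'' ((s' \<circ> s) w) / l w) \<longlongrightarrow> 1) cofinite"
    by (simp only: comp_apply mult_1)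
  moreover have "strict_mono (s' \<circ> s)"
    using assms by (auto simp: tame_def strict_mono_def)
  moreover have "surj (s' \<circ> s)"
    using assms by (intro comp_surj) (auto simp: tame_def)
  ultimately show ?thesis
    using assms by (auto simp only: tame_def)
qed

lemma tame_inv:
  assumes "tame l l' s"
  shows "tame l' l (inv_into UNIV s)"
proof -
  note b = tame_bij[OF assms]
  have "filterlim (inv_into UNIV s) cofinite cofinite"
    by (intro filterlim_inj_cofinite bij_is_inj bij_imp_bij_inv b)
  then have "((\<lambda>w. l' (s (inv_into UNIV s w)) / l (inv_into UNIV s w)) \<longlongrightarrow> 1) cofinite"
    using assms by (elim filterlim_compose[rotated]) (simp add: tame_def)
  then have "((\<lambda>w. inverse (l' (s (inv_into UNIV s w)) / l (inv_into UNIV s w))) \<longlongrightarrow> inverse 1) cofinite"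
    by (intro tendsto_inverse) auto
  then have lim: "((\<lambda>w. l (inv_into UNIV s w) / l' w) \<longlongrightarrow> 1) cofinite"
    by (simp add: surj_f_inv_f[OF bij_is_surj[OF b]])
  have "strict_mono (inv_into UNIV s)"
  proof (rule strict_monoI)
    fix x y :: 'a assume "x < y"
    then have "s (inv_into UNIV s x) < s (inv_into UNIV s y)"
      by (simp add: surj_f_inv_f[OF bij_is_surj[OF b]])
    then show "inv_into UNIV s x < inv_into UNIV s y"
      using assms strict_mono_less by (auto simp: tame_def)
  qed
  then show ?thesis
    using assms lim bij_is_surj[OF bij_imp_bij_inv[OF b]] by (simp add: tame_def)
qed

lemma tame_id: "lengths l \<Longrightarrow> tame l l id"
proof -
  assume l: "lengths l"
  have "(\<lambda>w. l (id w) / l w) = (\<lambda>w. 1)"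
    using lengths_pos[OF l] by (auto simp: less_imp_neq[symmetric])
  then show ?thesis
    using l by (auto simp: tame_def strict_mono_def)
qed

section \<open>The blown-up map and its derivative\<close>

definition slope :: "('w::{linorder,countable} \<Rightarrow> real) \<Rightarrow> ('w \<Rightarrow> real) \<Rightarrow> ('w \<Rightarrow> 'w) \<Rightarrow> real \<Rightarrow> real" where
  "slope l l' s x = (\<Sum>\<^sub>\<infinity>w. stretch (l w) (l' (s w)) (x - left l w))"

text \<open>The identity plus the displacements of all intervals. Lengths before and after may
  differ: group elements have \<open>l' = l\<close>, conjugacies have \<open>s = id\<close>.\<close>

definition blowup :: "('w::{linorder,countable} \<Rightarrow> real) \<Rightarrow> ('w \<Rightarrow> real) \<Rightarrow> ('w \<Rightarrow> 'w) \<Rightarrow> real \<Rightarrow> real" where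
  "blowup l l' s x =
     (if x \<in> {0..1} then x + (\<Sum>\<^sub>\<infinity>w. drift (l w) (l' (s w)) (left l w) x) else x)"

lemma blowup_outside: "x \<notin> {0..1} \<Longrightarrow> blowup l l' s x = x"
  unfolding blowup_def by (rule if_not_P)

lemma stretch_left_nonzero:
  assumes "lengths l" "stretch (l w) b (x - left l w) \<noteq> 0"
  shows "left l w < x" "x < left l w + l w"
  using stretch_zero[OF lengths_pos[OF assms(1)], of "x - left l w" w b] assms(2)
  by (auto simp: not_le[symmetric])

text \<open>The open intervals are disjoint and each summand vanishes off its own, so at most one
  summand is nonzero.\<close>

lemma slope_has_sum:
  assumes l: "lengths l"
  shows "((\<lambda>w. stretch (l w) (l' (s w)) (x - left l w)) has_sum slope l l' s x) UNIV"
    and "slope l l' s x = 0 \<or> (\<exists>w. slope l l' s x = stretch (l w) (l' (s w)) (x - left l w))"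
proof -
  let ?f = "\<lambda>w. stretch (l w) (l' (s w)) (x - left l w)"
  have "(?f has_sum 0) UNIV \<or> (\<exists>w. (?f has_sum ?f w) UNIV)"
  proof (cases "\<exists>w. ?f w \<noteq> 0")
    case True
    then obtain w where w: "?f w \<noteq> 0" by blast
    have "?f v = 0" if "v \<noteq> w" for v
      using left_disjoint[OF l stretch_left_nonzero[OF l w] stretch_left_nonzero[OF l]] that by blast
    then have "(?f has_sum ?f w) UNIV"
      by (intro has_sum_finite_neutralI[of "{w}"]) auto
    then show ?thesis by blast
  next
    case False
    then show ?thesis by simp
  qed
  then obtain c where c: "(?f has_sum c) UNIV" "c = 0 \<or> (\<exists>w. c = ?f w)"
    by blast
  have "slope l l' s x = c"
    unfolding slope_def by (rule infsumI[OF c(1)])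
  with c show "(?f has_sum slope l l' s x) UNIV"
    "slope l l' s x = 0 \<or> (\<exists>w. slope l l' s x = ?f w)"
    by simp_all
qed

lemma slope_gt:
  assumes "lengths l" "lengths l'"
  shows "slope l l' s x > -1"
  using slope_has_sum(2)[OF assms(1), of l' s x] stretch_gt lengths_pos assms by (metis neg_less_0_iff_less zero_less_one)

lemma slope_bound:
  assumes "lengths l" "lengths l'" "e \<ge> 0" "\<And>w. \<bar>(l' (s w) / l w)\<^sup>2 - 1\<bar> \<le> e"
  shows "\<bar>slope l l' s x\<bar> \<le> e"
  using slope_has_sum(2)[OF assms(1), of l' s x]
    stretch_bound[OF lengths_pos[OF assms(1)] lengths_pos[OF assms(2)] assms(4)] assms(3)
  by auto

text \<open>The length ratio tends to 1, so by \<open>stretch_bound\<close> all but finitely many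
  terms are uniformly small, and their supports are disjoint. Here the limit in \<open>tame\<close>
  turns into class C^1.\<close>

lemma slope_uniform_limit:
  fixes l :: "'w::{linorder,countable} \<Rightarrow> real"
  assumes "tame l l' s"
  shows "uniform_limit S (\<lambda>n x. \<Sum>i<n. if i \<in> range (to_nat :: 'w \<Rightarrow> nat)
      then stretch (l (from_nat i)) (l' (s (from_nat i))) (x - left l (from_nat i)) else 0)
    (slope l l' s) sequentially"
proof (rule uniform_limit_disjoint_supports)
  have l: "lengths l" "lengths l'" using assms by (auto simp: tame_def)
  let ?f = "\<lambda>i x. if i \<in> range (to_nat :: 'w \<Rightarrow> nat)
      then stretch (l (from_nat i)) (l' (s (from_nat i))) (x - left l (from_nat i)) else 0"
  show "i = j" if "?f i x \<noteq> 0" "?f j x \<noteq> 0" for i j x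
    using that left_disjoint[OF l(1) stretch_left_nonzero[OF l(1)] stretch_left_nonzero[OF l(1)]]
    by (auto split: if_splits)
  show "(\<lambda>i. ?f i x) sums slope l l' s x" for x
    by (rule has_sum_sums_to_nat[OF slope_has_sum(1)[OF l(1)]])
  fix e :: real assume e: "e > 0"
  have "((\<lambda>w. \<bar>(l' (s w) / l w)\<^sup>2 - 1\<bar>) \<longlongrightarrow> \<bar>1\<^sup>2 - 1\<bar>) cofinite"
    using assms by (intro tendsto_intros) (auto simp: tame_def)
  then have "\<forall>\<^sub>F w in cofinite. \<bar>(l' (s w) / l w)\<^sup>2 - 1\<bar> < e / 2"
    by (rule order_tendstoD) (use e in auto)
  then have "finite {w. \<not> \<bar>(l' (s w) / l w)\<^sup>2 - 1\<bar> < e / 2}"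
    by (simp add: eventually_cofinite)
  then have "finite (to_nat ` {w. \<not> \<bar>(l' (s w) / l w)\<^sup>2 - 1\<bar> < e / 2})"
    by simp
  then obtain m where m: "\<And>w. \<not> \<bar>(l' (s w) / l w)\<^sup>2 - 1\<bar> < e / 2 \<Longrightarrow> to_nat w < m"
    unfolding finite_nat_set_iff_bounded by blast
  have "\<bar>?f i x\<bar> < e" if "i \<ge> m" for i x
  proof (cases "i \<in> range (to_nat :: 'w \<Rightarrow> nat)")
    case True
    then obtain w :: 'w where w: "i = to_nat w" by blast
    then have "\<bar>(l' (s w) / l w)\<^sup>2 - 1\<bar> \<le> e / 2"
      using m[of w] that by fastforce
    then have "\<bar>stretch (l w) (l' (s w)) (x - left l w)\<bar> \<le> e / 2"
      using stretch_bound lengths_pos l by blast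
    then show ?thesis using w e by simp
  qed (use e in auto)
  then show "\<forall>\<^sub>F i in sequentially. \<forall>x. \<bar>?f i x\<bar> < e"
    unfolding eventually_sequentially by blast
qed

lemma slope_continuous:
  fixes l :: "'w::{linorder,countable} \<Rightarrow> real"
  assumes "tame l l' s"
  shows "continuous_on S (slope l l' s)"
proof (rule uniform_limit_theorem[OF _ slope_uniform_limit[OF assms] trivial_limit_sequentially])
  have "continuous_on S (\<lambda>x. stretch (l w) (l' (s w)) (x - left l w))" for w
    using assms by (intro continuous_on_compose2[OF stretch_continuous])
      (auto simp: tame_def lengths_pos intro: continuous_intros)
  then have "continuous_on S (\<lambda>x. if P then stretch (l w) (l' (s w)) (x - left l w) else 0)" for P w
    by (cases P) simp_all
  then show "\<forall>\<^sub>F n in sequentially. continuous_on S (\<lambda>x. \<Sum>i<n. if i \<in> range (to_nat :: 'w \<Rightarrow> nat)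
      then stretch (l (from_nat i)) (l' (s (from_nat i))) (x - left l (from_nat i)) else 0)"
    by (intro always_eventually allI continuous_on_sum)
qed

lemma drift_summable:
  assumes "tame l l' s" "x \<in> {0..1}"
  shows "(\<lambda>w. drift (l w) (l' (s w)) (left l w) x) summable_on A"
proof -
  have l: "lengths l" "lengths l'" using assms by (auto simp: tame_def)
  have "(\<lambda>w. l' (s w)) summable_on UNIV"
    using lengths_summable[OF l(2)] summable_on_reindex_bij_betw[OF tame_bij[OF assms(1)]] by blast
  then have "(\<lambda>w. l w + l' (s w)) summable_on UNIV"
    using lengths_summable[OF l(1)] by (intro summable_on_add)
  then have "(\<lambda>w. \<bar>drift (l w) (l' (s w)) (left l w) x\<bar>) summable_on UNIV"
    using l assms(2)
    by (elim summable_on_comparison_test)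
       (simp_all add: drift_bounds lengths_pos left_nonneg left_plus_le_1)
  then have "(\<lambda>w. drift (l w) (l' (s w)) (left l w) x) summable_on UNIV"
    using abs_summable_summable[of "\<lambda>w. drift (l w) (l' (s w)) (left l w) x" UNIV]
    by (simp only: real_norm_def)
  then show ?thesis
    by (rule summable_on_subset_banach) simp
qed

text \<open>Termwise differentiation of the drift series: it converges at 0, and the derivatives
  converge uniformly by \<open>slope_uniform_limit\<close>.\<close>

lemma blowup_deriv:
  fixes l :: "'w::{linorder,countable} \<Rightarrow> real"
  assumes "tame l l' s" "x \<in> {0..1}"
  shows "(blowup l l' s has_real_derivative 1 + slope l l' s x) (at x within {0..1})"
proof -
  have l: "lengths l" "lengths l'" using assms by (auto simp: tame_def)
  define D where "D x = (\<Sum>\<^sub>\<infinity>w. drift (l w) (l' (s w)) (left l w) x)" for x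
  let ?f = "\<lambda>i x. if i \<in> range (to_nat :: 'w \<Rightarrow> nat)
      then drift (l (from_nat i)) (l' (s (from_nat i))) (left l (from_nat i)) x else 0"
  let ?f' = "\<lambda>i x. if i \<in> range (to_nat :: 'w \<Rightarrow> nat)
      then stretch (l (from_nat i)) (l' (s (from_nat i))) (x - left l (from_nat i)) else 0"
  have sums: "(\<lambda>i. ?f i x) sums D x" if "x \<in> {0..1}" for x
    unfolding D_def using has_sum_infsum[OF drift_summable[OF assms(1) that]]
    by (rule has_sum_sums_to_nat)
  have "\<exists>g. \<forall>x\<in>{0..1}. (\<lambda>n. ?f n x) sums g x \<and> (g has_field_derivative slope l l' s x) (at x within {0..1})"
  proof (rule has_field_derivative_series[where f = ?f and f' = ?f' and ?x0.0 = 0])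
    show "(?f n has_real_derivative ?f' n x) (at x within {0..1})" if "x \<in> {0..1}" for n x
      using drift_deriv[of "l (from_nat n)" "l' (s (from_nat n))"] that l
      by (cases "n \<in> range (to_nat :: 'w \<Rightarrow> nat)") (auto simp: lengths_pos)
    show "summable (\<lambda>n. ?f n 0)"
      using sums[of 0] sums_summable by fastforce
  qed (auto intro: slope_uniform_limit[OF assms(1)])
  then obtain g where g: "\<And>x. x \<in> {0..1} \<Longrightarrow> (\<lambda>n. ?f n x) sums g x"
    "\<And>x. x \<in> {0..1} \<Longrightarrow> (g has_field_derivative slope l l' s x) (at x within {0..1})" by blast
  have "D x = g x" if "x \<in> {0..1}" for x
    using sums[OF that] g(1)[OF that] by (rule sums_unique2)
  then have eq: "x + g x = blowup l l' s x" if "x \<in> {0..1}" for x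
    using that by (simp add: blowup_def D_def)
  have "((\<lambda>x. x + g x) has_real_derivative 1 + slope l l' s x) (at x within {0..1})"
    by (intro DERIV_add DERIV_ident g assms)
  then show ?thesis
    by (rule has_field_derivative_transform_within[OF _ zero_less_one assms(2)]) (rule eq)
qed

lemma blowup_continuous: "tame l l' s \<Longrightarrow> continuous_on {0..1} (blowup l l' s)"
  by (rule DERIV_continuous_on) (rule blowup_deriv)

lemma tame_image_lessThan:
  assumes "tame l l' s"
  shows "s ` {..<w} = {..<s w}"
proof -
  have s: "strict_mono s" "surj s" using assms by (auto simp: tame_def)
  show ?thesis
  proof (intro equalityI subsetI)
    fix v assume v: "v \<in> {..<s w}"
    obtain u where "v = s u" using s(2) by blast
    then show "v \<in> s ` {..<w}" using v strict_mono_less[OF s(1)] by auto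
  qed (use strict_monoD[OF s(1)] in auto)
qed

text \<open>Intervals right of \<open>w\<close> contribute no drift, each interval \<open>v\<close>
  on the left contributes \<open>l' (s v) - l v\<close>, and inside \<open>w\<close> the drift keeps
  the coordinate \<open>t\<close>. As \<open>s\<close> maps the indices below \<open>w\<close> onto
  those below \<open>s w\<close>, the new lengths on the left add up to
  \<open>left l' (s w)\<close>.\<close>

lemma blowup_point:
  assumes "tame l l' s"
  shows "blowup l l' s (point l w t) = point l' (s w) t"
proof -
  have l: "lengths l" "lengths l'" using assms by (auto simp: tame_def)
  note pos = lengths_pos[OF l(1)] lengths_pos[OF l(2)]
  let ?x = "point l w t"
  let ?f = "\<lambda>v. drift (l v) (l' (s v)) (left l v) ?x"
  have x: "?x \<in> {0..1}" by (rule point_in_unit[OF l(1)])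
  have bij: "bij_betw s {..<w} {..<s w}"
    using tame_bij[OF assms] tame_image_lessThan[OF assms]
    by (metis bij_betw_imageI bij_is_inj inj_on_subset subset_UNIV)
  have split: "(UNIV :: 'a set) = insert w {..<w} \<union> {w<..}" by auto
  have "infsum ?f UNIV = infsum ?f (insert w {..<w}) + infsum ?f {w<..}"
    by (subst split, rule infsum_Un_disjoint) (auto intro: drift_summable[OF assms x])
  also have "infsum ?f {w<..} = infsum (\<lambda>v. 0) {w<..}"
  proof (rule infsum_cong)
    fix v assume "v \<in> {w<..}"
    then have "?x \<le> left l v"
      using left_less[OF l(1), of w v] point_bounds[OF l(1), of w t] by auto
    then show "?f v = 0" by (rule drift_before[OF pos(1)])
  qed
  also have "infsum ?f (insert w {..<w}) = ?f w + infsum ?f {..<w}"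
    by (rule infsum_insert) (auto intro: drift_summable[OF assms x])
  also have "?f w = yoccoz (l' (s w)) t - yoccoz (l w) t"
    unfolding point_def using l by (intro drift_inside pos left_nonneg left_plus_le_1)
  also have "infsum ?f {..<w} = infsum (\<lambda>v. l' (s v) - l v) {..<w}"
  proof (rule infsum_cong)
    fix v assume "v \<in> {..<w}"
    then have "left l v + l v \<le> ?x"
      using left_less[OF l(1), of v w] point_bounds[OF l(1), of w t] by auto
    then show "?f v = l' (s v) - l v"
      using x l by (intro drift_after pos left_nonneg) auto
  qed
  also have "\<dots> = infsum (\<lambda>v. l' (s v)) {..<w} - infsum l {..<w}"
  proof -
    have "(\<lambda>v. l' (s v)) summable_on {..<w}"
      using summable_on_reindex_bij_betw[OF bij, of l'] lengths_summable[OF l(2)] by blast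
    then show ?thesis
      using infsum_add[of "\<lambda>v. l' (s v)" "{..<w}" "\<lambda>v. - l v"] lengths_summable[OF l(1), of "{..<w}"]
      by (simp add: summable_on_uminus infsum_uminus)
  qed
  also have "infsum (\<lambda>v. l' (s v)) {..<w} = left l' (s w)"
    unfolding left_def by (rule infsum_reindex_bij_betw[OF bij])
  finally show ?thesis
    using x by (simp add: blowup_def point_def left_def)
qed

lemma blowup_in_unit:
  assumes "tame l l' s" "x \<in> {0..1}"
  shows "blowup l l' s x \<in> {0..1}"
proof -
  have l: "lengths l" "lengths l'" using assms by (auto simp: tame_def)
  have "blowup l l' s ` closure (points l) \<subseteq> {0..1}"
  proof (rule image_closure_subset)
    show "continuous_on (closure (points l)) (blowup l l' s)"
      using blowup_continuous[OF assms(1)] closure_points[OF l(1)] by simp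
    show "blowup l l' s ` points l \<subseteq> {0..1}"
      using point_in_unit[OF l(2)] by (auto simp: points_def blowup_point[OF assms(1)])
  qed simp
  then show ?thesis using assms(2) closure_points[OF l(1)] by blast
qed

text \<open>By \<open>blowup_point\<close> both sides agree on the dense set \<open>points\<close>,
  and both are continuous.\<close>

lemma blowup_comp:
  assumes "tame l l' s" "tame l' l'' s'"
  shows "blowup l' l'' s' \<circ> blowup l l' s = blowup l l'' (s' \<circ> s)"
proof
  fix x
  show "(blowup l' l'' s' \<circ> blowup l l' s) x = blowup l l'' (s' \<circ> s) x"
  proof (cases "x \<in> {0..1}")
    case True
    have l: "lengths l" using assms by (auto simp: tame_def)
    note t = tame_comp[OF assms]
    have "blowup l' l'' s' (blowup l l' s x) - blowup l l'' (s' \<circ> s) x = 0"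
    proof (rule continuous_constant_on_closure[where S = "points l" and
        f = "\<lambda>x. blowup l' l'' s' (blowup l l' s x) - blowup l l'' (s' \<circ> s) x"])
      show "continuous_on (closure (points l))
          (\<lambda>x. blowup l' l'' s' (blowup l l' s x) - blowup l l'' (s' \<circ> s) x)"
        unfolding closure_points[OF l]
        by (intro continuous_on_diff blowup_continuous[OF t] continuous_on_compose2[OF blowup_continuous[OF assms(2)]]
            blowup_continuous[OF assms(1)]) (use blowup_in_unit[OF assms(1)] in blast)
      show "x \<in> closure (points l)" using True closure_points[OF l] by simp
      fix y assume "y \<in> points l"
      then show "blowup l' l'' s' (blowup l l' s y) - blowup l l'' (s' \<circ> s) y = 0"
        by (auto simp: points_def blowup_point[OF assms(1)] blowup_point[OF assms(2)] blowup_point[OF t])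
    qed
    then show ?thesis by simp
  qed (simp add: blowup_outside)
qed

lemma blowup_id: "lengths l \<Longrightarrow> blowup l l id = id"
  by (auto simp: blowup_def lengths_pos)

lemma blowup_inv:
  assumes "tame l l' s"
  shows "blowup l' l (inv_into UNIV s) \<circ> blowup l l' s = id" "blowup l l' s \<circ> blowup l' l (inv_into UNIV s) = id"
proof -
  have "inv_into UNIV s \<circ> s = id" "s \<circ> inv_into UNIV s = id"
    using tame_bij[OF assms] by (auto simp: bij_is_inj surj_iff[symmetric] bij_is_surj)
  then show "blowup l' l (inv_into UNIV s) \<circ> blowup l l' s = id"
    "blowup l l' s \<circ> blowup l' l (inv_into UNIV s) = id"
    using blowup_comp[OF assms tame_inv[OF assms]] blowup_comp[OF tame_inv[OF assms] assms] assms
    by (auto simp: blowup_id tame_def)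
qed

lemma inv_blowup:
  assumes "tame l l' s"
  shows "inv_into UNIV (blowup l l' s) = blowup l' l (inv_into UNIV s)"
  using blowup_inv[OF assms] by (rule inv_unique_comp[rotated])

section \<open>Regularity and distance to the identity\<close>

lemma blowup_C1: "tame l l' s \<Longrightarrow> C1_on_unit (blowup l l' s)"
  unfolding C1_on_unit_def
  by (intro exI[of _ "\<lambda>x. 1 + slope l l' s x"] conjI ballI blowup_deriv continuous_intros slope_continuous)

text \<open>The inverse is again a blow-up, of the inverse order automorphism, so both directions
  are of class C^1; monotonicity comes from the positive derivative.\<close>

lemma blowup_Diff1:
  assumes "tame l l' s"
  shows "blowup l l' s \<in> Diff1_plus"
proof -
  let ?f = "blowup l l' s" and ?g = "blowup l' l (inv_into UNIV s)"
  note t' = tame_inv[OF assms]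
  have fg: "?g (?f x) = x" "?f (?g x) = x" for x
    using blowup_inv[OF assms] by (metis comp_apply id_apply)+
  have bij: "bij_betw ?f {0..1} {0..1}"
    by (rule bij_betw_byWitness[where f' = ?g])
      (use fg blowup_in_unit[OF assms] blowup_in_unit[OF t'] in auto)
  have inv: "inv_into {0..1} ?f x = ?g x" if "x \<in> {0..1}" for x
    using that bij fg blowup_in_unit[OF t' that] by (metis bij_betw_def inv_into_f_f)
  obtain g' where g': "continuous_on {0..1} g'"
    "\<And>x. x \<in> {0..1} \<Longrightarrow> (?g has_real_derivative g' x) (at x within {0..1})"
    using blowup_C1[OF t'] by (auto simp: C1_on_unit_def)
  have "(inv_into {0..1} ?f has_real_derivative g' x) (at x within {0..1})" if "x \<in> {0..1}" for x
    by (rule has_field_derivative_transform_within[OF g'(2)[OF that] zero_less_one that]) (simp add: inv)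
  with g' have "C1_on_unit (inv_into {0..1} ?f)"
    by (auto simp: C1_on_unit_def)
  moreover have "mono_on {0..1} ?f"
  proof (rule mono_onI)
    fix x y :: real assume xy: "x \<in> {0..1}" "y \<in> {0..1}" "x \<le> y"
    show "?f x \<le> ?f y"
    proof (rule DERIV_nonneg_imp_increasing_open[OF xy(3)])
      fix z assume z: "x < z" "z < y"
      have "(?f has_real_derivative 1 + slope l l' s z) (at z within {0..1})"
        using z xy by (intro blowup_deriv[OF assms]) auto
      moreover have "at z within {0..1} = at z"
        using z xy by (intro at_within_interior) auto
      moreover have "slope l l' s z > -1"
        using assms by (intro slope_gt) (auto simp: tame_def)
      ultimately show "\<exists>d. (?f has_real_derivative d) (at z) \<and> 0 \<le> d"
        by (intro exI[of _ "1 + slope l l' s z"]) auto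
    next
      show "continuous_on {x..y} ?f"
        using blowup_continuous[OF assms] by (rule continuous_on_subset) (use xy in auto)
    qed
  qed
  ultimately show ?thesis
    using bij blowup_C1[OF assms] by (auto simp: Diff1_plus_def blowup_outside)
qed

lemma D01_eq:
  assumes "x \<in> {0..1}" "(f has_real_derivative d) (at x within {0..1})"
  shows "D01 f x = d"
  unfolding D01_def using assms
  by (intro vector_derivative_within_cbox[of 0 1, unfolded cbox_interval])
     (auto simp: has_real_derivative_iff_has_vector_derivative)

lemma blowup_fix_0:
  assumes "tame l l' s"
  shows "blowup l l' s 0 = 0"
proof -
  have "drift (l w) (l' (s w)) (left l w) 0 = 0" for w
    using assms by (intro drift_before) (auto simp: tame_def lengths_pos left_nonneg)
  then show ?thesis by (simp add: blowup_def)
qed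

lemma blowup_C1_close:
  assumes "tame l l' s" "e \<ge> 0" "\<And>w. \<bar>(l' (s w) / l w)\<^sup>2 - 1\<bar> \<le> e" "x \<in> {0..1}"
  shows "\<bar>blowup l l' s x - x\<bar> \<le> e" "\<bar>D01 (blowup l l' s) x - 1\<bar> \<le> e"
proof -
  have l: "lengths l" "lengths l'" using assms by (auto simp: tame_def)
  have b: "\<bar>slope l l' s y\<bar> \<le> e" for y
    by (rule slope_bound[OF l assms(2,3)])
  show "\<bar>D01 (blowup l l' s) x - 1\<bar> \<le> e"
    using D01_eq[OF assms(4) blowup_deriv[OF assms(1,4)]] b by simp
  \<comment> \<open>Mean value inequality starting from the fixed point 0: closeness of the
    derivatives forces closeness of the values.\<close>
  have "norm ((blowup l l' s x - x) - (blowup l l' s 0 - 0)) \<le> e * norm (x - 0)"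
  proof (rule field_differentiable_bound)
    show "((\<lambda>x. blowup l l' s x - x) has_field_derivative (1 + slope l l' s z - 1)) (at z within {0..1})"
      if "z \<in> {0..1}" for z
      by (intro DERIV_diff DERIV_ident blowup_deriv[OF assms(1) that])
  qed (use b assms in auto)
  also have "\<dots> \<le> e * 1"
    using assms by (intro mult_left_mono) auto
  finally show "\<bar>blowup l l' s x - x\<bar> \<le> e"
    by (simp add: blowup_fix_0[OF assms(1)])
qed

section \<open>The free group acting on integer lists\<close>

text \<open>With \<open>s = 1\<close>, \<open>g = False\<close> is the generator a and
  \<open>g = True\<close> is b. The left neighbour of a changed position has the other parity and
  stays, so the additions do not interfere and \<open>- s\<close> undoes \<open>s\<close>.\<close>

definition shear :: "bool \<Rightarrow> int \<Rightarrow> int list \<Rightarrow> int list" where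
  "shear g s v = map (\<lambda>j. v ! j + (if 0 < j \<and> even j = g then s * v ! (j - 1) else 0)) [0..<length v]"

lemma length_shear [simp]: "length (shear g s v) = length v"
  by (simp add: shear_def)

lemma nth_shear:
  "j < length v \<Longrightarrow> shear g s v ! j = v ! j + (if 0 < j \<and> even j = g then s * v ! (j - 1) else 0)"
  by (simp add: shear_def)

lemma shear_uminus: "shear g (- s) (shear g s v) = v"
  by (rule nth_equalityI) (auto simp: nth_shear)

lemma list_less_iff:
  fixes v w :: "'a::linorder list"
  shows "v < w \<longleftrightarrow> length v < length w \<or>
    length v = length w \<and> (\<exists>k<length v. take k v = take k w \<and> v ! k < w ! k)"
  by (auto simp: list_less_def lenlex_conv lexord_lex lexord_take_index_conv)

text \<open>At the first position where two lists differ, both receive the same addition, since it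
  depends only on the entry before; earlier positions still agree.\<close>

lemma shear_strict_mono: "strict_mono (shear g s)"
proof (rule strict_monoI)
  fix v w :: "int list"
  assume "v < w"
  then consider "length v < length w"
    | k where "length v = length w" "k < length v" "take k v = take k w" "v ! k < w ! k"
    by (auto simp: list_less_iff)
  then show "shear g s v < shear g s w"
  proof cases
    case 2
    have eq: "v ! j = w ! j" if "j < k" for j
      using 2(3) that by (metis nth_take)
    have "take k (shear g s v) = take k (shear g s w)"
      using 2 eq by (intro nth_equalityI) (auto simp: nth_shear)
    moreover have "shear g s v ! k < shear g s w ! k"
      using 2 eq[of "k - 1"] by (auto simp: nth_shear)
    ultimately show ?thesis
      using 2 unfolding list_less_iff by auto
  qed (simp add: list_less_iff)
qed

section \<open>The action of words\<close>

definition letter :: "letter2 \<Rightarrow> int list \<Rightarrow> int list" where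
  "letter x = shear (fst x) (if snd x then -1 else 1)"

fun flip :: "letter2 \<Rightarrow> letter2" where
  "flip (g, i) = (g, \<not> i)"

lemma letter_flip: "letter (flip x) \<circ> letter x = id" "letter x \<circ> letter (flip x) = id"
  using shear_uminus[of _ 1] shear_uminus[of _ "-1"]
  by (cases x; auto simp: letter_def fun_eq_iff)+

lemma letter_cancels: "cancels x y \<Longrightarrow> letter x \<circ> letter y = id"
proof -
  assume "cancels x y"
  then have "x = flip y" by (cases x; cases y) (auto simp: cancels_def)
  then show ?thesis by (simp add: letter_flip)
qed

fun word :: "letter2 list \<Rightarrow> int list \<Rightarrow> int list" where
  "word [] = id"
| "word (x # xs) = letter x \<circ> word xs"

definition inv_word :: "letter2 list \<Rightarrow> letter2 list" where
  "inv_word xs = map flip (rev xs)"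

lemma word_append: "word (xs @ ys) = word xs \<circ> word ys"
  by (induction xs) (auto simp: o_assoc)

lemma word_red: "word (red xs) = word xs"
proof (induction xs)
  case (Cons x xs)
  show ?case
  proof (cases "red xs")
    case Nil
    then have "word xs = id" using Cons word.simps(1) by metis
    then show ?thesis using Nil by simp
  next
    case (Cons y ys)
    then have w: "word xs = letter y \<circ> word ys"
      using \<open>word (red xs) = word xs\<close> by simp
    show ?thesis
    proof (cases "cancels x y")
      case True
      have "letter x \<circ> (letter y \<circ> word ys) = word ys"
        using letter_cancels[OF True] by (simp add: o_assoc)
      then show ?thesis using Cons True w by simp
    qed (use Cons w in simp)
  qed
qed simp

lemma word_inv: "word (inv_word xs) \<circ> word xs = id" "word xs \<circ> word (inv_word xs) = id"
proof -
  have "word (inv_word xs) (word xs v) = v" for v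
    using letter_flip(1) by (induction xs) (auto simp: inv_word_def word_append fun_eq_iff)
  moreover have "word xs (word (inv_word xs) v) = v" for v
    using letter_flip(2) by (induction xs arbitrary: v) (auto simp: inv_word_def word_append fun_eq_iff)
  ultimately show "word (inv_word xs) \<circ> word xs = id" "word xs \<circ> word (inv_word xs) = id"
    by (auto simp: fun_eq_iff)
qed

section \<open>Reduced words and faithfulness of the action\<close>

lemma reduced_iff: "reduced xs \<longleftrightarrow> successively (\<lambda>x y. \<not> cancels x y) xs"
  by (auto simp: reduced_def successively_conv_nth)

lemma reduced_red: "reduced (red xs)"
  by (induction xs) (auto simp: reduced_iff successively_Cons split: list.splits)

lemma reduced_inv_word: "reduced xs \<Longrightarrow> reduced (inv_word xs)"
  unfolding reduced_iff inv_word_def successively_map successively_rev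
  by (erule successively_mono) (auto simp: cancels_def)

lemma length_word [simp]: "length (word xs v) = length v"
  by (induction xs) (auto simp: letter_def)

text \<open>
  The invariant behind faithfulness: each new syllable of a reduced word moves the last nonzero
  entry one place to the right, and a further letter of the same syllable adds to that entry with
  the same sign. The starting position k0 is chosen so that the rightmost letter acts on it.
\<close>

lemma word_top_entry:
  assumes "xs \<noteq> []" "reduced xs" "k0 = (if fst (last xs) then 1 else 0 :: nat)" "length xs + k0 < L"
  shows "\<exists>k n. k0 < k \<and> k \<le> k0 + length xs \<and> even k = fst (hd xs) \<and> n > 0 \<and>
    word xs ((replicate L 0)[k0 := 1]) ! (k - 1) \<noteq> 0 \<and>
    word xs ((replicate L 0)[k0 := 1]) ! k
      = (if snd (hd xs) then -1 else 1) * n * word xs ((replicate L 0)[k0 := 1]) ! (k - 1) \<and>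
    (\<forall>j<L. k < j \<longrightarrow> word xs ((replicate L 0)[k0 := 1]) ! j = 0)"
  using assms
proof (induction xs rule: list_nonempty_induct)
  case (single x)
  obtain g i where x: "x = (g, i)" by (cases x)
  show ?case
    using single by (intro exI[of _ "Suc k0"] exI[of _ 1]) (auto simp: x letter_def nth_shear)
next
  case (cons x xs)
  obtain g i where x: "x = (g, i)" by (cases x)
  define v where "v = (replicate L (0::int))[k0 := 1]"
  define u where "u = word xs v"
  have red: "reduced xs" "\<not> cancels x (hd xs)"
    using cons.prems cons.hyps by (auto simp: reduced_iff successively_Cons)
  have k0: "k0 = (if fst (last xs) then 1 else 0)" using cons by simp
  obtain k n where k: "k0 < k" "k \<le> k0 + length xs" "even k = fst (hd xs)" "n > 0" "u ! (k - 1) \<noteq> 0"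
    "u ! k = (if snd (hd xs) then -1 else 1) * n * u ! (k - 1)" "\<And>j. j < L \<Longrightarrow> k < j \<Longrightarrow> u ! j = 0"
    using cons.IH red(1) cons.prems k0 unfolding v_def u_def by auto
  have len: "length u = L" by (simp add: u_def v_def)
  have step: "word (x # xs) v = shear g (if i then -1 else 1) u"
    by (simp add: x letter_def u_def)
  have "\<exists>k' n'. k0 < k' \<and> k' \<le> k0 + length (x # xs) \<and> even k' = g \<and> n' > 0 \<and>
      shear g (if i then -1 else 1) u ! (k' - 1) \<noteq> 0 \<and>
      shear g (if i then -1 else 1) u ! k' = (if i then -1 else 1) * n' * shear g (if i then -1 else 1) u ! (k' - 1) \<and>
      (\<forall>j<L. k' < j \<longrightarrow> shear g (if i then -1 else 1) u ! j = 0)"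
  proof (cases "g = fst (hd xs)")
    case True
    \<comment> \<open>Same generator without cancellation means same exponent. The witness
      \<open>n\<close> counts the letters of the current syllable, and entry \<open>k - 1\<close>,
      of the other parity, stays fixed.\<close>
    then have i: "snd (hd xs) = i"
      using red(2) by (simp add: cancels_def x)
    have "shear g (if i then -1 else 1) u ! (k - 1) = u ! (k - 1)"
      using k True cons.prems len by (cases k) (auto simp: nth_shear)
    moreover have "shear g (if i then -1 else 1) u ! k = (if i then -1 else 1) * (n + 1) * u ! (k - 1)"
      using k True cons.prems len by (auto simp: nth_shear i algebra_simps)
    moreover have "\<forall>j<L. k < j \<longrightarrow> shear g (if i then -1 else 1) u ! j = 0"
    proof (intro allI impI)
      fix j assume j: "j < L" "k < j"
      show "shear g (if i then -1 else 1) u ! j = 0"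
      \<comment> \<open>Position \<open>k + 1\<close> has a nonzero left neighbour but the wrong
        parity; further right, both entries involved are 0.\<close>
      proof (cases "j = Suc k")
        case False
        then show ?thesis using j k(7)[of j] k(7)[of "j - 1"] len by (auto simp: nth_shear)
      qed (use j k True len in \<open>auto simp: nth_shear\<close>)
    qed
    ultimately show ?thesis
      using k True by (intro exI[of _ k] exI[of _ "n + 1"]) auto
  next
    case False
    have "shear g (if i then -1 else 1) u ! k = u ! k"
      using k False cons.prems len by (auto simp: nth_shear)
    moreover have "u ! k \<noteq> 0" using k by auto
    moreover have "shear g (if i then -1 else 1) u ! Suc k = (if i then -1 else 1) * u ! k"
      using k False cons.prems len by (auto simp: nth_shear)
    moreover have "\<forall>j<L. Suc k < j \<longrightarrow> shear g (if i then -1 else 1) u ! j = 0"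
      using k(7) len by (auto simp: nth_shear)
    ultimately show ?thesis
      using k False by (intro exI[of _ "Suc k"] exI[of _ 1]) auto
  qed
  then show ?case
    unfolding v_def[symmetric] step by (simp add: x)
qed

lemma word_nontrivial:
  assumes "xs \<noteq> []" "reduced xs"
  shows "word xs \<noteq> id"
proof
  assume id: "word xs = id"
  let ?k0 = "if fst (last xs) then 1 else 0 :: nat"
  \<comment> \<open>Long enough to contain the top entry, which sits at most at
    \<open>?k0 + length xs\<close>. If the word acted trivially that entry would be 0, as the basis
    vector vanishes beyond \<open>?k0\<close>.\<close>
  let ?L = "length xs + ?k0 + 1"
  obtain k n where "?k0 < k" "k \<le> ?k0 + length xs" "(n::int) > 0"
    "((replicate ?L 0)[?k0 := 1]) ! (k - 1) \<noteq> (0::int)"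
    "((replicate ?L 0)[?k0 := 1]) ! k = (if snd (hd xs) then -1 else 1) * n * ((replicate ?L 0)[?k0 := 1]) ! (k - 1)"
    using word_top_entry[OF assms refl, of ?L] id by auto
  then show False by (auto split: if_splits)
qed

text \<open>Equal first letters are cancelled and induction applies. Otherwise
  \<open>inv_word (x # xs) @ ys\<close> is a nonempty reduced word acting trivially, against
  \<open>word_nontrivial\<close>.\<close>

lemma word_inj:
  assumes "reduced xs" "reduced ys" "word xs = word ys"
  shows "xs = ys"
  using assms
proof (induction xs arbitrary: ys)
  case Nil
  then show ?case using word_nontrivial[of ys] word.simps(1) by metis
next
  case (Cons x xs)
  show ?case
  proof (cases ys)
    case Nil
    then show ?thesis
      using word_nontrivial[of "x # xs"] Cons.prems word.simps(1) by (metis list.distinct(1))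
  next
    case ys: (Cons y zs)
    show ?thesis
    proof (cases "x = y")
      case True
      have "letter (flip x) \<circ> (letter x \<circ> word xs) = letter (flip x) \<circ> (letter x \<circ> word zs)"
        using Cons.prems(3) unfolding ys True word.simps by (rule arg_cong)
      then have "word xs = word zs"
        by (simp add: o_assoc letter_flip)
      moreover have "reduced xs" "reduced zs"
        using Cons.prems ys by (auto simp: reduced_iff successively_Cons)
      ultimately show ?thesis using Cons.IH True ys by blast
    next
      case False
      \<comment> \<open>At the junction \<open>flip x\<close> meets \<open>y\<close>, and these
        cancel only if \<open>x = y\<close>.\<close>
      have "reduced (inv_word (x # xs) @ ys)"
        using reduced_inv_word[OF Cons.prems(1)] Cons.prems(2) False ys
        by (cases x; cases y) (auto simp: reduced_iff successively_append_iff inv_word_def cancels_def)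
      moreover have "word (inv_word (x # xs) @ ys) = id"
        using word_inv(1)[of "x # xs"] unfolding Cons.prems(3) word_append .
      ultimately show ?thesis
        using word_nontrivial[of "inv_word (x # xs) @ ys"] ys by simp
    qed
  qed
qed

section \<open>Slowly varying lengths\<close>

lemma power_perturbation:
  fixes e :: real
  assumes "even p" "e > 0"
  obtains C where "\<And>x y :: real. \<bar>(x + y) ^ p - x ^ p\<bar> \<le> e * (x ^ p + y ^ (2 * p)) + C"
proof -
  \<comment> \<open>If y is small relative to x, then x^p absorbs the error; otherwise it is O(y^p), which y^(2p) absorbs.\<close>
  have "((\<lambda>z::real. (1 + z) ^ p) \<longlongrightarrow> (1 + 0) ^ p) (at 0)"
    by (intro tendsto_intros)
  then obtain d where d: "d > 0" "\<And>z. z \<noteq> 0 \<Longrightarrow> \<bar>z\<bar> < d \<Longrightarrow> \<bar>(1 + z) ^ p - 1\<bar> < e"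
    using assms(2) unfolding LIM_def by (auto simp: dist_real_def)
  define M where "M = (1 / d + 1) ^ p + (1 / d) ^ p"
  have "\<bar>(x + y) ^ p - x ^ p\<bar> \<le> e * (x ^ p + y ^ (2 * p)) + M\<^sup>2 / e" for x y :: real
  proof (cases "x \<noteq> 0 \<and> y \<noteq> 0 \<and> \<bar>y\<bar> < d * \<bar>x\<bar>")
    case True
    then have "\<bar>(1 + y / x) ^ p - 1\<bar> < e"
      using d(1) by (intro d(2)) (simp_all add: abs_divide pos_divide_less_eq)
    then have "\<bar>x ^ p\<bar> * \<bar>(1 + y / x) ^ p - 1\<bar> \<le> \<bar>x ^ p\<bar> * e"
      by (intro mult_left_mono) auto
    moreover have "x ^ p * ((1 + y / x) ^ p - 1) = (x + y) ^ p - x ^ p"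
      using True by (simp add: right_diff_distrib distrib_left flip: power_mult_distrib)
    ultimately have "\<bar>(x + y) ^ p - x ^ p\<bar> \<le> \<bar>x ^ p\<bar> * e"
      by (metis abs_mult)
    also have "\<dots> = e * x ^ p"
      using assms(1) by (simp add: mult.commute zero_le_even_power)
    also have "\<dots> \<le> e * (x ^ p + y ^ (2 * p)) + M\<^sup>2 / e"
      using assms by (simp add: distrib_left zero_le_even_power)
    finally show ?thesis .
  next
    case False
    show ?thesis
    proof (cases "y = 0")
      case True
      then show ?thesis using assms by (simp add: zero_le_even_power)
    next
      case y: False
      have xy: "\<bar>x\<bar> \<le> 1 / d * \<bar>y\<bar>"
        using False y d(1) by (cases "x = 0") (auto simp: field_simps)
      define u where "u = \<bar>y\<bar> ^ p"
      have "\<bar>(x + y) ^ p - x ^ p\<bar> \<le> \<bar>x + y\<bar> ^ p + \<bar>x\<bar> ^ p"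
        using abs_triangle_ineq4[of "(x + y) ^ p" "x ^ p"] by (simp add: power_abs)
      also have "\<dots> \<le> ((1 / d + 1) * \<bar>y\<bar>) ^ p + (1 / d * \<bar>y\<bar>) ^ p"
      proof (intro add_mono power_mono)
        show "\<bar>x + y\<bar> \<le> (1 / d + 1) * \<bar>y\<bar>"
          using xy abs_triangle_ineq[of x y] by (simp add: distrib_right)
      qed (use xy in auto)
      also have "\<dots> = M * u"
        unfolding M_def u_def power_mult_distrib by (simp only: distrib_right)
      also have "M * u \<le> e * u\<^sup>2 + M\<^sup>2 / e"
      proof -
        have "0 \<le> (e * u - M)\<^sup>2 + e\<^sup>2 * u\<^sup>2 + M\<^sup>2" by simp
        then have "e * (M * u) \<le> e * (e * u\<^sup>2 + M\<^sup>2 / e)"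
          using assms(2) by (simp add: power2_eq_square algebra_simps)
        then show ?thesis
          using assms(2) mult_le_cancel_left_pos by blast
      qed
      also have "u\<^sup>2 = y ^ (2 * p)"
        unfolding u_def power_mult[symmetric] mult.commute[of p] by (rule power_even_abs) simp
      also have "e * y ^ (2 * p) + M\<^sup>2 / e \<le> e * (x ^ p + y ^ (2 * p)) + M\<^sup>2 / e"
        using assms by (simp add: distrib_left zero_le_even_power)
      finally show ?thesis .
    qed
  qed
  then show ?thesis using that by blast
qed

text \<open>The exponents halve along the list, down to 2 for the last entry. The entry that a shear
  adds to position \<open>j\<close> thus occurs with twice the exponent of position
  \<open>j\<close>, which is the shape of \<open>power_perturbation\<close>; \<open>B\<close> is an
  adjustable offset.\<close>

definition height :: "real \<Rightarrow> int list \<Rightarrow> real" where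
  "height B v = B + (\<Sum>j<length v. real_of_int (v ! j) ^ (2 ^ (length v - j)))"

lemma height_ge: "height B v \<ge> B"
  unfolding height_def
  by (simp, intro sum_nonneg zero_le_even_power) auto

lemma height_ge_entry:
  assumes "j < length v" "B \<ge> 0"
  shows "real_of_int (v ! j) ^ (2 ^ (length v - j)) \<le> height B v - B"
  using assms member_le_sum[of j "{..<length v}" "\<lambda>j. real_of_int (v ! j) ^ (2 ^ (length v - j))"]
  by (auto simp: height_def zero_le_even_power)

text \<open>Relies on integrality: a nonzero integer has absolute value at least 1, so its powers do
  not decrease with the exponent.\<close>

lemma entry_power_ge:
  fixes x :: int
  assumes "0 < k"
  shows "(real_of_int x)\<^sup>2 \<le> real_of_int x ^ (2 ^ k)"
proof (cases "x = 0")
  case False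
  have "(2::nat) ^ 1 \<le> 2 ^ k"
    using assms by (intro power_increasing) auto
  then have "\<bar>real_of_int x\<bar> ^ 2 \<le> \<bar>real_of_int x\<bar> ^ (2 ^ k)"
    using False by (intro power_increasing) (auto simp flip: of_int_abs)
  then show ?thesis
    using assms by (simp add: power_even_abs)
qed (use assms in simp)

text \<open>Converts estimates valid for large height into estimates off a finite set, one list
  length at a time.\<close>

lemma finite_height_less:
  assumes "B \<ge> 0"
  shows "finite {v. length v = d \<and> height B v < M}"
proof (rule finite_subset)
  show "{v. length v = d \<and> height B v < M} \<subseteq> {v. set v \<subseteq> {-\<lceil>M\<rceil>..\<lceil>M\<rceil>} \<and> length v = d}"
  proof safe
    fix v x assume v: "height B v < M" "x \<in> set v" "d = length v"
    then obtain j where j: "j < length v" "x = v ! j" by (metis in_set_conv_nth)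
    have "\<bar>real_of_int x\<bar> \<le> (real_of_int x)\<^sup>2"
    proof -
      have "\<bar>x\<bar> \<le> x\<^sup>2"
        by (metis abs_ge_zero int_one_le_iff_zero_less order_le_less power2_abs self_le_power zero_less_numeral zero_power2)
      then show ?thesis by (metis of_int_abs of_int_le_iff of_int_power)
    qed
    also have "\<dots> \<le> real_of_int x ^ (2 ^ (length v - j))"
      using j by (intro entry_power_ge) auto
    also have "\<dots> \<le> M"
      using height_ge_entry[OF j(1) assms] j v assms by simp
    finally show "x \<in> {-\<lceil>M\<rceil>..\<lceil>M\<rceil>}"
      by (simp, linarith)
  qed
qed (rule finite_lists_length_eq, simp)

text \<open>By \<open>power_perturbation\<close> each changed entry costs at most a small multiple
  of the height plus a constant, and a large height absorbs the constants. The threshold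
  \<open>M\<close> is independent of \<open>B\<close>, so \<open>B\<close> can later be chosen above
  it.\<close>

lemma height_shear:
  assumes "e > 0"
  obtains M where "\<And>B v g s. B \<ge> 1 \<Longrightarrow> length v = d \<Longrightarrow> \<bar>s\<bar> = 1 \<Longrightarrow> height B v \<ge> M \<Longrightarrow>
    \<bar>height B (shear g s v) / height B v - 1\<bar> \<le> e"
proof -
  \<comment> \<open>Chosen so that \<open>d\<close> entries, each with error
    \<open>2 * e' * N\<close>, add up to at most \<open>e / 2 * N\<close>; the other half of
    \<open>e\<close> pays for the constants collected in \<open>K\<close>.\<close>
  define e' where "e' = e / (4 * (real d + 1))"
  have e': "e' > 0" using assms by (simp add: e'_def)
  have "\<exists>C. \<forall>x y :: real. \<bar>(x + y) ^ (2 ^ (d - j)) - x ^ (2 ^ (d - j))\<bar>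
      \<le> e' * (x ^ (2 ^ (d - j)) + y ^ (2 * 2 ^ (d - j))) + C" if "j < d" for j
    using power_perturbation[of "2 ^ (d - j)" e'] e' that by (metis even_power even_numeral zero_less_diff)
  then obtain C where C: "\<And>j x y. j < d \<Longrightarrow> \<bar>(x + y) ^ (2 ^ (d - j)) - x ^ (2 ^ (d - j))\<bar>
      \<le> e' * (x ^ (2 ^ (d - j)) + y ^ (2 * 2 ^ (d - j))) + C j" for x y :: real
    by metis
  define K where "K = (\<Sum>j<d. \<bar>C j\<bar>)"
  have "\<bar>height B (shear g s v) / height B v - 1\<bar> \<le> e"
    if asm: "B \<ge> 1" "length v = d" "\<bar>s\<bar> = 1" "height B v \<ge> 2 * K / e" for B v g s
  proof -
    define N where "N = height B v"
    have N: "N > 0" using height_ge[of B v] asm by (simp add: N_def)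
    have "\<bar>real_of_int (shear g s v ! j) ^ (2 ^ (d - j)) - real_of_int (v ! j) ^ (2 ^ (d - j))\<bar>
        \<le> 2 * e' * N + \<bar>C j\<bar>" if j: "j < d" for j
    proof (cases "0 < j \<and> even j = g")
      case True
      let ?x = "real_of_int (v ! j)" and ?y = "real_of_int (s * v ! (j - 1))"
      have "\<bar>(?x + ?y) ^ (2 ^ (d - j)) - ?x ^ (2 ^ (d - j))\<bar>
          \<le> e' * (?x ^ (2 ^ (d - j)) + ?y ^ (2 * 2 ^ (d - j))) + C j"
        by (rule C[OF j])
      also have "?x ^ (2 ^ (d - j)) \<le> N"
        using height_ge_entry[of j v B] j asm by (simp add: N_def)
      also have "?y ^ (2 * 2 ^ (d - j)) \<le> N"
      proof -
        \<comment> \<open>Entry \<open>j - 1\<close> enters the height with exactly this exponent,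
          so its power is bounded by the height.\<close>
        have "2 * 2 ^ (d - j) = (2::nat) ^ (d - (j - 1))"
          using True j by (simp add: Suc_diff_Suc flip: power_Suc)
        moreover have "?y ^ (2 * 2 ^ (d - j)) = real_of_int (v ! (j - 1)) ^ (2 * 2 ^ (d - j))"
        proof -
          have "s = 1 \<or> s = -1" using \<open>\<bar>s\<bar> = 1\<close> by linarith
          then show ?thesis by auto
        qed
        moreover have "j - 1 < length v"
          using j asm(2) by simp
        ultimately show ?thesis
          using height_ge_entry[of "j - 1" v B] asm(1,2)
          by (simp only: N_def) (smt (verit, best))
      qed
      finally have "\<bar>(?x + ?y) ^ (2 ^ (d - j)) - ?x ^ (2 ^ (d - j))\<bar> \<le> 2 * e' * N + C j"
        using e' by (simp add: ac_simps)
      also have "\<dots> \<le> 2 * e' * N + \<bar>C j\<bar>" by simp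
      finally show ?thesis
        using True j asm(2) by (simp add: nth_shear)
    next
      case False
      then show ?thesis using j asm e' N by (auto simp: nth_shear)
    qed
    then have "\<bar>\<Sum>j<d. real_of_int (shear g s v ! j) ^ (2 ^ (d - j)) - real_of_int (v ! j) ^ (2 ^ (d - j))\<bar>
        \<le> (\<Sum>j<d. 2 * e' * N + \<bar>C j\<bar>)"
      by (intro order_trans[OF sum_abs] sum_mono) auto
    then have "\<bar>height B (shear g s v) - N\<bar> \<le> real d * (2 * e' * N) + K"
      using asm by (simp add: height_def N_def K_def sum.distrib sum_subtractf)
    also have "real d * (2 * e' * N) \<le> e / 2 * N"
    proof -
      have "real d * (2 * e') \<le> e / 2"
        using assms by (simp add: e'_def field_simps)
      then show ?thesis using N by (metis mult.assoc mult_right_mono order_less_imp_le)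
    qed
    also have "K \<le> e / 2 * N"
      using asm assms by (simp add: N_def field_simps)
    finally have "\<bar>height B (shear g s v) - N\<bar> \<le> e * N"
      by (simp add: mult.commute)
    then have "\<bar>(height B (shear g s v) - N) / N\<bar> \<le> e"
      using N by (simp add: abs_divide divide_le_eq)
    then show ?thesis
      using N by (simp add: N_def diff_divide_distrib)
  qed
  then show ?thesis using that by blast
qed

section \<open>Weights as powers of the inverse height\<close>

definition weight :: "real \<Rightarrow> real \<Rightarrow> int list \<Rightarrow> real" where
  "weight c B v = (c / height B v) ^ length v"

lemma weight_pos: "c > 0 \<Longrightarrow> B \<ge> 1 \<Longrightarrow> weight c B v > 0"
  using height_ge[of B v] by (simp add: weight_def)

lemma weight_ratio:
  assumes "c > 0" "B \<ge> 1" "B' \<ge> 1" "length v' = length v"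
  shows "weight c B' v' / weight c B v = inverse (height B' v' / height B v) ^ length v"
  using assms height_ge[of B v] height_ge[of B' v']
  by (simp add: weight_def power_divide[symmetric])

lemma inverse_power_near_1:
  fixes e :: real
  assumes "e > 0"
  obtains d where "d > 0" "\<And>r. \<bar>r - 1\<bar> \<le> d \<Longrightarrow> \<bar>inverse r ^ n - 1\<bar> < e"
proof -
  have "((\<lambda>r::real. inverse r ^ n) \<longlongrightarrow> inverse 1 ^ n) (at 1)"
    by (intro tendsto_intros) auto
  then obtain d where d: "d > 0" "\<And>r. r \<noteq> 1 \<Longrightarrow> \<bar>r - 1\<bar> < d \<Longrightarrow> \<bar>inverse r ^ n - 1\<bar> < e"
    using assms unfolding LIM_def by (auto simp: dist_real_def)
  have "\<bar>inverse r ^ n - 1\<bar> < e" if "\<bar>r - 1\<bar> \<le> d / 2" for r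
    using d that assms by (cases "r = 1") auto
  then show ?thesis using that[of "d / 2"] d(1) by simp
qed

lemma weight_shear:
  assumes "e > 0" "c > 0"
  obtains M where "\<And>B v g s. B \<ge> 1 \<Longrightarrow> length v = d \<Longrightarrow> \<bar>s\<bar> = 1 \<Longrightarrow> height B v \<ge> M \<Longrightarrow>
    \<bar>weight c B (shear g s v) / weight c B v - 1\<bar> < e"
proof -
  obtain e' where e': "e' > 0" "\<And>r. \<bar>r - 1\<bar> \<le> e' \<Longrightarrow> \<bar>inverse r ^ d - 1\<bar> < e"
    using inverse_power_near_1[OF assms(1)] by blast
  obtain M where M: "\<And>B v g s. B \<ge> 1 \<Longrightarrow> length v = d \<Longrightarrow> \<bar>s\<bar> = 1 \<Longrightarrow> height B v \<ge> M \<Longrightarrow>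
      \<bar>height B (shear g s v) / height B v - 1\<bar> \<le> e'"
    using height_shear[OF e'(1)] by blast
  have "\<bar>weight c B (shear g s v) / weight c B v - 1\<bar> < e"
    if "B \<ge> 1" "length v = d" "\<bar>s\<bar> = 1" "height B v \<ge> M" for B v g s
    using e'(2)[OF M[OF that]] weight_ratio[OF assms(2) that(1,1), of "shear g s v" v] that by simp
  then show ?thesis using that by blast
qed

text \<open>Changing the offset changes the height by the constant \<open>B' - B\<close>, which is
  negligible when the height is large.\<close>

lemma weight_offset:
  assumes "e > 0" "c > 0" "B \<ge> 1" "B' \<ge> 1"
  obtains M where "\<And>v. length v = d \<Longrightarrow> height B v \<ge> M \<Longrightarrow> \<bar>weight c B' v / weight c B v - 1\<bar> < e"
proof -
  obtain e' where e': "e' > 0" "\<And>r. \<bar>r - 1\<bar> \<le> e' \<Longrightarrow> \<bar>inverse r ^ d - 1\<bar> < e"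
    using inverse_power_near_1[OF assms(1)] by blast
  have "\<bar>weight c B' v / weight c B v - 1\<bar> < e" if v: "length v = d" "height B v \<ge> \<bar>B' - B\<bar> / e'" for v
  proof -
    have N: "height B v > 0" using height_ge[of B v] assms by simp
    have "height B' v / height B v - 1 = (B' - B) / height B v"
      using N by (simp add: field_simps) (simp add: height_def)
    then have "\<bar>height B' v / height B v - 1\<bar> \<le> e'"
      using N v e'(1) by (simp add: abs_divide field_simps)
    then show ?thesis
      using e'(2)[of "height B' v / height B v"] weight_ratio[OF assms(2-4), of v v] v by simp
  qed
  then show ?thesis using that by blast
qed

section \<open>Summability of the weights over all lists\<close>

lemma sum_inverse_squares_int:
  obtains c :: real where "c > 0" "\<And>A :: int set. finite A \<Longrightarrow> (\<Sum>x\<in>A. c / (1 + (real_of_int x)\<^sup>2)) \<le> 1 / 3"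
proof -
  define h where "h n = 1 / (1 + (real n)\<^sup>2)" for n
  have h0: "h n \<ge> 0" for n by (simp add: h_def)
  have "summable (\<lambda>n. inverse (real n ^ 2))"
    by (rule inverse_power_summable) simp
  then have h: "summable h"
  proof (rule summable_comparison_test_ev[rotated])
    show "\<forall>\<^sub>F n in sequentially. norm (h n) \<le> inverse (real n ^ 2)"
      using eventually_gt_at_top[of 0]
      by eventually_elim (auto simp: h_def inverse_eq_divide intro!: divide_left_mono mult_pos_pos add_pos_nonneg)
  qed
  \<comment> \<open>Each natural number is the absolute value of at most two integers, whence the
    factor 2.\<close>
  define K where "K = 2 * suminf h"
  have "h 0 \<le> suminf h"
    using sum_le_suminf[OF h, of "{0}"] h0 by simp
  then have K: "K > 0" by (simp add: K_def h_def)
  have bound: "(\<Sum>x\<in>A. h (nat \<bar>x\<bar>)) \<le> K" if A: "finite A" for A :: "int set"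
  proof -
    have half: "(\<Sum>x\<in>A'. h (nat \<bar>x\<bar>)) \<le> suminf h" if "finite A'" "inj_on (\<lambda>x. nat \<bar>x\<bar>) A'" for A' :: "int set"
    proof -
      have "(\<Sum>x\<in>A'. h (nat \<bar>x\<bar>)) = sum h ((\<lambda>x. nat \<bar>x\<bar>) ` A')"
        using that by (simp add: sum.reindex)
      also have "\<dots> \<le> suminf h"
        using that h h0 by (intro sum_le_suminf) auto
      finally show ?thesis .
    qed
    have "A = (A \<inter> {0..}) \<union> (A \<inter> {..<0})" by auto
    then have "(\<Sum>x\<in>A. h (nat \<bar>x\<bar>)) = (\<Sum>x\<in>(A \<inter> {0..}) \<union> (A \<inter> {..<0}). h (nat \<bar>x\<bar>))"
      by simp
    also have "\<dots> = (\<Sum>x\<in>A \<inter> {0..}. h (nat \<bar>x\<bar>)) + (\<Sum>x\<in>A \<inter> {..<0}. h (nat \<bar>x\<bar>))"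
      using A by (intro sum.union_disjoint) auto
    also have "\<dots> \<le> suminf h + suminf h"
      using A by (intro add_mono half) (auto simp: inj_on_def)
    finally show ?thesis by (simp add: K_def)
  qed
  have "(\<Sum>x\<in>A. (1 / (3 * K)) / (1 + (real_of_int x)\<^sup>2)) \<le> 1 / 3" if "finite A" for A :: "int set"
  proof -
    have "(\<Sum>x\<in>A. (1 / (3 * K)) / (1 + (real_of_int x)\<^sup>2)) = 1 / (3 * K) * (\<Sum>x\<in>A. h (nat \<bar>x\<bar>))"
      by (simp add: h_def sum_distrib_left)
    also have "\<dots> \<le> 1 / (3 * K) * K"
      using K bound[OF that] by (intro mult_left_mono) auto
    finally show ?thesis using K by simp
  qed
  then show ?thesis using that[of "1 / (3 * K)"] K by simp
qed

text \<open>Expansion of the n-th power of a sum: a list records which term each factor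
  contributes.\<close>

lemma sum_prod_list_length:
  fixes f :: "'a \<Rightarrow> real"
  assumes "finite A"
  shows "(\<Sum>v | set v \<subseteq> A \<and> length v = n. \<Prod>x\<leftarrow>v. f x) = (\<Sum>x\<in>A. f x) ^ n"
proof (induction n)
  case 0
  have "{v. set v \<subseteq> A \<and> length v = 0} = {[]}" by auto
  then show ?case by simp
next
  case (Suc n)
  have "(\<Sum>v | set v \<subseteq> A \<and> length v = Suc n. \<Prod>x\<leftarrow>v. f x)
      = (\<Sum>(v, x)\<in>{v. set v \<subseteq> A \<and> length v = n} \<times> A. f x * (\<Prod>x\<leftarrow>v. f x))"
    unfolding lists_length_Suc_eq by (subst sum.reindex) (auto simp: inj_on_def intro!: sum.cong)
  also have "\<dots> = (\<Sum>v | set v \<subseteq> A \<and> length v = n. \<Prod>x\<leftarrow>v. f x) * (\<Sum>x\<in>A. f x)"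
    unfolding sum_product by (subst sum.cartesian_product[symmetric]) (simp add: mult.commute)
  finally show ?case using Suc by simp
qed

text \<open>Sorting by length turns the sum into a geometric series of ratio at most 1 / 3 that
  starts at length 1, which gives the bound 1 / 2.\<close>

lemma sum_prod_list_bound:
  fixes f :: "'a \<Rightarrow> real"
  assumes nonneg: "\<And>x. f x \<ge> 0" and small: "\<And>A. finite A \<Longrightarrow> sum f A \<le> 1 / 3"
    and F: "finite F" "[] \<notin> F"
  shows "(\<Sum>v\<in>F. \<Prod>x\<leftarrow>v. f x) \<le> 1 / 2"
proof -
  define A where "A = \<Union> (set ` F)"
  \<comment> \<open>The inserted 0 keeps \<open>Max\<close> meaningful when \<open>F\<close> is
    empty.\<close>
  define D where "D = Max (insert 0 (length ` F))"
  have A: "finite A" using F by (simp add: A_def)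
  have D: "length v \<le> D" if "v \<in> F" for v
    using F that by (auto simp: D_def)
  have "F \<subseteq> (\<Union>n\<in>{1..D}. {v. set v \<subseteq> A \<and> length v = n})"
    using D F(2) by (fastforce simp: A_def Suc_le_eq)
  then have "(\<Sum>v\<in>F. \<Prod>x\<leftarrow>v. f x) \<le> (\<Sum>v\<in>(\<Union>n\<in>{1..D}. {v. set v \<subseteq> A \<and> length v = n}). \<Prod>x\<leftarrow>v. f x)"
    using A nonneg by (intro sum_mono2) (auto intro!: finite_lists_length_eq prod_list_nonneg)
  also have "\<dots> = (\<Sum>n=1..D. \<Sum>v | set v \<subseteq> A \<and> length v = n. \<Prod>x\<leftarrow>v. f x)"
    using A by (intro sum.UNION_disjoint) (auto intro!: finite_lists_length_eq)
  also have "\<dots> = (\<Sum>n=1..D. (\<Sum>x\<in>A. f x) ^ n)"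
    by (simp add: sum_prod_list_length[OF A])
  also have "\<dots> \<le> (\<Sum>n=1..D. (1 / 3) ^ n)"
    using small[OF A] nonneg by (intro sum_mono power_mono sum_nonneg) auto
  also have "\<dots> = 1 / 2 - (1 / 3) ^ D / 2"
    by (induction D) simp_all
  also have "\<dots> \<le> 1 / 2" by simp
  finally show ?thesis .
qed

text \<open>The height dominates \<open>1 + x^2\<close> for every entry \<open>x\<close>, so the
  power splits into factors that can be summed entry by entry.\<close>

lemma weight_le_prod:
  assumes "c > 0" "B \<ge> 1"
  shows "weight c B v \<le> (\<Prod>x\<leftarrow>v. c / (1 + (real_of_int x)\<^sup>2))"
proof -
  have "weight c B v = (\<Prod>j<length v. c / height B v)"
    by (simp add: weight_def)
  also have "\<dots> \<le> (\<Prod>j<length v. c / (1 + (real_of_int (v ! j))\<^sup>2))"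
  proof (intro prod_mono conjI)
    fix j assume j: "j \<in> {..<length v}"
    have "(real_of_int (v ! j))\<^sup>2 \<le> height B v - B"
      using j assms entry_power_ge[of "length v - j" "v ! j"] height_ge_entry[of j v B] by auto
    then show "c / height B v \<le> c / (1 + (real_of_int (v ! j))\<^sup>2)"
      using assms height_ge[of B v] by (intro divide_left_mono mult_pos_pos) (auto intro: add_pos_nonneg)
    show "0 \<le> c / height B v"
      using height_ge[of B v] assms by simp
  qed
  also have "\<dots> = (\<Prod>x\<leftarrow>v. c / (1 + (real_of_int x)\<^sup>2))"
    by (induction v) (simp_all add: prod.lessThan_Suc_shift del: prod.lessThan_Suc)
  finally show ?thesis .
qed

section \<open>Construction of the length functions\<close>

lemma letter_Nil [simp]: "letter x [] = []"
  by (simp add: letter_def shear_def)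

lemma length_letter [simp]: "length (letter x v) = length v"
  by (simp add: letter_def)

lemma letter_order_automorphism: "strict_mono (letter x)" "surj (letter x)"
proof -
  show "strict_mono (letter x)" by (simp add: letter_def shear_strict_mono)
  show "surj (letter x)"
    using letter_flip(2)[of x] by (metis comp_apply id_apply surjI)
qed

text \<open>\<open>l 0\<close> carries the group and \<open>l n\<close> its conjugate at stage
  \<open>n\<close>; the last estimate makes the conjugated letters converge to the identity.\<close>

lemma length_functions_exist:
  obtains l :: "nat \<Rightarrow> int list \<Rightarrow> real"
  where "\<And>n. lengths (l n)" "\<And>n x. tame (l n) (l n) (letter x)" "\<And>n. tame (l 0) (l n) id"
    "\<And>n x v. \<bar>l n (letter x v) / l n v - 1\<bar> < 1 / (real n + 1)"
proof -
  obtain c :: real where c: "c > 0"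
    "\<And>A :: int set. finite A \<Longrightarrow> (\<Sum>x\<in>A. c / (1 + (real_of_int x)\<^sup>2)) \<le> 1 / 3"
    using sum_inverse_squares_int by blast
  have "\<exists>B\<ge>1. \<forall>v x. length v = d \<longrightarrow> \<bar>weight c B (letter x v) / weight c B v - 1\<bar> < 1 / (real e + 1)" for d e :: nat
  proof -
    have e: "1 / (real e + 1) > 0" by simp
    obtain M where M: "\<And>B v g s. B \<ge> 1 \<Longrightarrow> length v = d \<Longrightarrow> \<bar>s\<bar> = 1 \<Longrightarrow> height B v \<ge> M \<Longrightarrow>
        \<bar>weight c B (shear g s v) / weight c B v - 1\<bar> < 1 / (real e + 1)"
      using weight_shear[OF e c(1)] by blast
    show ?thesis
    \<comment> \<open>A height is never below its offset, so the offset \<open>max 1 M\<close> puts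
      every list beyond the threshold \<open>M\<close>.\<close>
    proof (intro exI[of _ "max 1 M"] conjI allI impI)
      fix v :: "int list" and x assume "length v = d"
      moreover have "height (max 1 M) v \<ge> M" using height_ge[of "max 1 M" v] by simp
      ultimately show "\<bar>weight c (max 1 M) (letter x v) / weight c (max 1 M) v - 1\<bar> < 1 / (real e + 1)"
        unfolding letter_def by (intro M) auto
    qed simp
  qed
  then obtain \<beta> where \<beta>: "\<And>d e. \<beta> d e \<ge> 1"
    "\<And>d e v x. length v = d \<Longrightarrow>
      \<bar>weight c (\<beta> d e) (letter x v) / weight c (\<beta> d e) v - 1\<bar> < 1 / (real e + 1)" for d e :: nat
    by metis
  \<comment> \<open>Lists of length \<open>d\<close> get the tolerance index \<open>max d n\<close>:
    its growth in \<open>d\<close> makes ratios tend to 1 for long lists, \<open>n\<close> gives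
    uniform closeness, and for \<open>d >= n\<close> the offset is the one used at stage 0, so only
    finitely many lengths \<open>d\<close> are affected.\<close>
  define w where "w n v = weight c (\<beta> (length v) (max (length v) n)) v" for n v
  have w_pos: "w n v > 0" for n v
    unfolding w_def by (intro weight_pos c \<beta>)
  have w_sum: "sum (w n) F \<le> 1 / 2" if "finite F" "[] \<notin> F" for n F
  proof -
    have "sum (w n) F \<le> (\<Sum>v\<in>F. \<Prod>x\<leftarrow>v. c / (1 + (real_of_int x)\<^sup>2))"
      unfolding w_def by (intro sum_mono weight_le_prod c \<beta>)
    also have "\<dots> \<le> 1 / 2"
      using c by (intro sum_prod_list_bound that) (auto simp: add_nonneg_nonneg)
    finally show ?thesis .
  qed
  have summ: "w n summable_on (- {[]})" for n
    using w_sum w_pos by (intro nonneg_bdd_above_summable_on bdd_aboveI[of _ "1 / 2"]) (auto simp: less_imp_le)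
  have infs: "infsum (w n) (- {[]}) \<le> 1 / 2" for n
    using w_sum by (intro infsum_le_finite_sums summ) auto
  \<comment> \<open>The empty list, fixed by all letters, takes the remaining length, at least 1 /
    2, so that the total is 1.\<close>
  define l where "l n v = (if v = [] then 1 - infsum (w n) (- {[]}) else w n v)" for n v
  have lengths: "lengths (l n)" for n
    unfolding lengths_def
  proof (intro conjI allI)
    show "l n v > 0" for v using infs[of n] w_pos by (auto simp: l_def)
    have "(w n has_sum infsum (w n) (- {[]})) (- {[]})"
      by (rule has_sum_infsum[OF summ])
    then have "(l n has_sum infsum (w n) (- {[]})) (- {[]})"
      by (rule has_sum_cong[THEN iffD1, rotated]) (simp add: l_def)
    then have "(l n has_sum (l n [] + infsum (w n) (- {[]}))) (insert [] (- {[]}))"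
      by (intro has_sum_insert) auto
    moreover have "insert [] (- {[]}) = (UNIV :: int list set)" by auto
    ultimately show "(l n has_sum 1) UNIV" by (simp add: l_def)
  qed
  have ratio: "l n (letter x v) / l n v =
      weight c (\<beta> (length v) (max (length v) n)) (letter x v) / weight c (\<beta> (length v) (max (length v) n)) v" for n x v
  proof (cases "v = []")
    case True
    then show ?thesis
      using lengths_pos[OF lengths, of n "[]"] by (simp add: weight_def)
  next
    case False
    then have "letter x v \<noteq> []" by (metis length_0_conv length_letter)
    then show ?thesis using False by (simp add: l_def w_def)
  qed
  have close: "\<bar>l n (letter x v) / l n v - 1\<bar> < 1 / (real (max (length v) n) + 1)" for n x v
    unfolding ratio using \<beta>(2) by blast
  have tame_letter: "tame (l n) (l n) (letter x)" for n x
    unfolding tame_def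
  proof (intro conjI lengths letter_order_automorphism tendstoI)
    fix e :: real assume e: "e > 0"
    then obtain D where D: "1 / (real D + 1) < e"
      using reals_Archimedean[of e] by (auto simp: inverse_eq_divide add.commute)
    have "\<exists>M. \<forall>B v x. B \<ge> 1 \<longrightarrow> length v = d \<longrightarrow> height B v \<ge> M \<longrightarrow>
        \<bar>weight c B (letter x v) / weight c B v - 1\<bar> < e" for d
    proof -
      obtain M where M: "\<And>B v g s. B \<ge> 1 \<Longrightarrow> length v = d \<Longrightarrow> \<bar>s\<bar> = 1 \<Longrightarrow> height B v \<ge> M \<Longrightarrow>
          \<bar>weight c B (shear g s v) / weight c B v - 1\<bar> < e"
        using weight_shear[OF e c(1)] by blast
      then show ?thesis unfolding letter_def by (intro exI[of _ M]) auto
    qed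
    then obtain M where M: "\<And>d B v x. B \<ge> 1 \<Longrightarrow> length v = d \<Longrightarrow> height B v \<ge> M d \<Longrightarrow>
        \<bar>weight c B (letter x v) / weight c B v - 1\<bar> < e"
      by metis
    \<comment> \<open>Lists longer than \<open>D\<close> obey the bound through their tolerance; for
      each of the finitely many remaining lengths \<open>d\<close>, exceptions have height below
      \<open>M d\<close>.\<close>
    have "{v. \<not> dist (l n (letter x v) / l n v) 1 < e}
        \<subseteq> (\<Union>d\<le>D. {v. length v = d \<and> height (\<beta> d (max d n)) v < M d})"
    proof
      fix v assume "v \<in> {v. \<not> dist (l n (letter x v) / l n v) 1 < e}"
      then have v: "\<not> \<bar>l n (letter x v) / l n v - 1\<bar> < e" by (simp add: dist_real_def)
      have "length v \<le> D"
      proof (rule ccontr)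
        assume "\<not> length v \<le> D"
        then have "1 / (real (max (length v) n) + 1) \<le> 1 / (real D + 1)"
          by (intro divide_left_mono) auto
        then show False using close[of n x v] v D by linarith
      qed
      moreover have "height (\<beta> (length v) (max (length v) n)) v < M (length v)"
        using M[OF \<beta>(1) refl, of v] v unfolding ratio by (meson not_less)
      ultimately show "v \<in> (\<Union>d\<le>D. {v. length v = d \<and> height (\<beta> d (max d n)) v < M d})" by blast
    qed
    moreover have "finite (\<Union>d\<le>D. {v. length v = d \<and> height (\<beta> d (max d n)) v < M d})"
      using \<beta>(1) by (intro finite_UN_I finite_height_less) (auto intro: order_trans[of 0 1])
    ultimately show "\<forall>\<^sub>F v in cofinite. dist (l n (letter x v) / l n v) 1 < e"
      unfolding eventually_cofinite using finite_subset by blast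
  qed
  have tame_change: "tame (l 0) (l n) id" for n
    unfolding tame_def
  proof (intro conjI lengths tendstoI)
    fix e :: real assume e: "e > 0"
    have "\<exists>M. \<forall>v. length v = d \<longrightarrow> height (\<beta> d (max d 0)) v \<ge> M \<longrightarrow>
        \<bar>weight c (\<beta> d (max d n)) v / weight c (\<beta> d (max d 0)) v - 1\<bar> < e" for d
      using weight_offset[OF e c(1) \<beta>(1) \<beta>(1)] by metis
    then obtain M where M: "\<And>d v. length v = d \<Longrightarrow> height (\<beta> d (max d 0)) v \<ge> M d \<Longrightarrow>
        \<bar>weight c (\<beta> d (max d n)) v / weight c (\<beta> d (max d 0)) v - 1\<bar> < e"
      by metis
    \<comment> \<open>For lists longer than \<open>n\<close> the two length functions coincide; up
      to length \<open>n\<close>, \<open>weight_offset\<close> handles large heights. The empty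
      list, which holds the normalising remainder, is set aside.\<close>
    have "{v. \<not> dist (l n (id v) / l 0 v) 1 < e}
        \<subseteq> insert [] (\<Union>d\<le>n. {v. length v = d \<and> height (\<beta> d (max d 0)) v < M d})"
    proof
      fix v assume "v \<in> {v. \<not> dist (l n (id v) / l 0 v) 1 < e}"
      then have v: "\<not> \<bar>l n v / l 0 v - 1\<bar> < e" by (simp add: dist_real_def)
      show "v \<in> insert [] (\<Union>d\<le>n. {v. length v = d \<and> height (\<beta> d (max d 0)) v < M d})"
      proof (cases "v = []")
        case False
        have "length v \<le> n"
        proof (rule ccontr)
          assume "\<not> length v \<le> n"
          then have "l n v = l 0 v" using False by (simp add: l_def w_def max_def)
          then show False using v e lengths_pos[OF lengths, of 0 v] by simp
        qed
        moreover have "height (\<beta> (length v) (max (length v) 0)) v < M (length v)"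
        proof -
          have "l n v / l 0 v = weight c (\<beta> (length v) (max (length v) n)) v
              / weight c (\<beta> (length v) (max (length v) 0)) v"
            using False by (simp add: l_def w_def)
          then show ?thesis using M[OF refl, of v] v by (metis not_less)
        qed
        ultimately show ?thesis by blast
      qed simp
    qed
    moreover have "finite (insert [] (\<Union>d\<le>n. {v. length v = d \<and> height (\<beta> d (max d 0)) v < M d}))"
      using \<beta>(1) by (intro finite.insertI finite_UN_I finite_height_less) (auto intro: order_trans[of 0 1])
    ultimately show "\<forall>\<^sub>F v in cofinite. dist (l n (id v) / l 0 v) 1 < e"
      unfolding eventually_cofinite using finite_subset by blast
  qed (auto simp: strict_mono_def)
  have "\<bar>l n (letter x v) / l n v - 1\<bar> < 1 / (real n + 1)" for n x v
  proof -
    have "1 / (real (max (length v) n) + 1) \<le> 1 / (real n + 1)"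
      by (intro divide_left_mono) auto
    then show ?thesis using close[of n x v] by linarith
  qed
  then show ?thesis
    using that lengths tame_letter tame_change by blast
qed

section \<open>From letters to words, and the resulting group\<close>

lemma near_one_mult:
  fixes a b d :: real
  assumes "d \<le> 1" "\<bar>a - 1\<bar> < d" "\<bar>b - 1\<bar> < d"
  shows "\<bar>a * b - 1\<bar> < 3 * d"
proof -
  have "\<bar>a - 1\<bar> * \<bar>b - 1\<bar> \<le> 1 * \<bar>b - 1\<bar>"
    using assms by (intro mult_right_mono) auto
  moreover have "a * b - 1 = (a - 1) * (b - 1) + (a - 1) + (b - 1)"
    by (simp add: algebra_simps)
  moreover define q where "q = (a - 1) * (b - 1)"
  ultimately have "\<bar>q\<bar> \<le> \<bar>b - 1\<bar>" "a * b - 1 = q + (a - 1) + (b - 1)"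
    by (simp_all add: abs_mult)
  then show ?thesis
    using assms by linarith
qed

text \<open>The ratio for a word is a product of letter ratios along the orbit of \<open>v\<close>,
  with as many factors as the word has letters; closeness uniform in \<open>v\<close> survives such
  products.\<close>

lemma word_uniformly_close:
  assumes lengths: "\<And>n. lengths (l n)"
    and close: "\<And>n x v. \<bar>l n (letter x v) / l n v - 1\<bar> < 1 / (real n + 1)"
    and "e > 0"
  shows "\<forall>\<^sub>F n in sequentially. \<forall>v. \<bar>l n (word xs v) / l n v - 1\<bar> < e"
  using \<open>e > 0\<close>
proof (induction xs arbitrary: e)
  case Nil
  then show ?case
    using lengths_pos[OF lengths] by (simp add: less_imp_neq[symmetric])
next
  case (Cons x xs)
  define d where "d = min 1 (e / 3)"
  have d: "d > 0" "d \<le> 1" "3 * d \<le> e" using Cons.prems by (auto simp: d_def)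
  have "(\<lambda>n. 1 / (real n + 1)) \<longlonglongrightarrow> 0"
    using LIMSEQ_inverse_real_of_nat by (simp add: inverse_eq_divide add.commute)
  then have "\<forall>\<^sub>F n in sequentially. 1 / (real n + 1) < d"
    by (rule order_tendstoD) (rule d)
  with Cons.IH[OF d(1)] show ?case
  proof eventually_elim
    case (elim n)
    show ?case
    proof
      fix v
      have "\<bar>l n (letter x (word xs v)) / l n (word xs v) - 1\<bar> < d"
        using close[of n x "word xs v"] elim by linarith
      moreover have "\<bar>l n (word xs v) / l n v - 1\<bar> < d" using elim by blast
      ultimately have "\<bar>l n (letter x (word xs v)) / l n (word xs v) * (l n (word xs v) / l n v) - 1\<bar> < 3 * d"
        by (rule near_one_mult[OF d(2)])
      then show "\<bar>l n (word (x # xs) v) / l n v - 1\<bar> < e"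
        using d(3) lengths_pos[OF lengths, of n "word xs v"] by simp
    qed
  qed
qed

theorem theoremt:
  shows "\<exists>G. subgroup_Diff1 G \<and> C1_close_to_id G \<and> diff_group G \<cong> F2"
proof -
  obtain l :: "nat \<Rightarrow> int list \<Rightarrow> real" where lengths: "\<And>n. lengths (l n)"
    and tame_letter: "\<And>n x. tame (l n) (l n) (letter x)" and tame_change: "\<And>n. tame (l 0) (l n) id"
    and close: "\<And>n x v. \<bar>l n (letter x v) / l n v - 1\<bar> < 1 / (real n + 1)"
    using length_functions_exist by blast
  have tame_word: "tame (l n) (l n) (word xs)" for n xs
  proof (induction xs)
    case Nil
    show ?case unfolding word.simps by (rule tame_id[OF lengths])
  next
    case (Cons x xs)
    then show ?case unfolding word.simps by (rule tame_comp[OF _ tame_letter])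
  qed
  define \<Phi> where "\<Phi> xs = blowup (l 0) (l 0) (word xs)" for xs
  have \<Phi>_append: "\<Phi> (xs @ ys) = \<Phi> xs \<circ> \<Phi> ys" for xs ys
    unfolding \<Phi>_def word_append by (rule blowup_comp[OF tame_word tame_word, symmetric])
  have \<Phi>_red: "\<Phi> (red xs) = \<Phi> xs" for xs
    by (simp add: \<Phi>_def word_red)
  have \<Phi>_inv: "inv_into UNIV (\<Phi> xs) = \<Phi> (inv_word xs)" for xs
    using inv_blowup[OF tame_word] inv_unique_comp[OF word_inv(2,1)] by (simp add: \<Phi>_def)
  have \<Phi>_inj: "inj_on \<Phi> {xs. reduced xs}"
  proof (rule inj_onI)
    fix xs ys assume red: "xs \<in> {xs. reduced xs}" "ys \<in> {xs. reduced xs}" and eq: "\<Phi> xs = \<Phi> ys"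
    have "word xs v = word ys v" for v
    proof (rule point_inj[OF lengths])
      \<comment> \<open>A blow-up reveals where its word sends \<open>v\<close>: by
        \<open>blowup_point\<close>, the point with coordinate 0 over \<open>v\<close> goes to the
        one over the image of \<open>v\<close>.\<close>
      show "point (l 0) (word xs v) 0 = point (l 0) (word ys v) 0"
        using eq blowup_point[OF tame_word, of 0 _ v 0] unfolding \<Phi>_def by metis
    qed
    then show "xs = ys" using word_inj red by blast
  qed
  define G where "G = range \<Phi>"
  have G_red: "G = \<Phi> ` {xs. reduced xs}"
  proof (intro equalityI subsetI)
    fix f assume "f \<in> G"
    then obtain xs where "f = \<Phi> (red xs)" using \<Phi>_red by (auto simp: G_def)
    then show "f \<in> \<Phi> ` {xs. reduced xs}" using reduced_red by blast
  qed (auto simp: G_def)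
  have "subgroup_Diff1 G"
    unfolding subgroup_Diff1_def
  proof (intro conjI ballI)
    show "G \<subseteq> Diff1_plus"
      using blowup_Diff1[OF tame_word] by (auto simp: G_def \<Phi>_def)
    have "\<Phi> [] = id" by (simp add: \<Phi>_def blowup_id[OF lengths])
    then show "id \<in> G" unfolding G_def by (metis rangeI)
    show "f \<circ> g \<in> G" if "f \<in> G" "g \<in> G" for f g
    proof -
      obtain xs ys where "f = \<Phi> xs" "g = \<Phi> ys" using \<open>f \<in> G\<close> \<open>g \<in> G\<close> by (auto simp: G_def)
      then have "f \<circ> g = \<Phi> (xs @ ys)" using \<Phi>_append by simp
      then show ?thesis by (simp add: G_def)
    qed
    show "inv_into UNIV f \<in> G" if "f \<in> G" for f
      using that \<Phi>_inv by (auto simp: G_def)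
  qed
  moreover have "C1_close_to_id G"
    unfolding C1_close_to_id_def
  \<comment> \<open>The conjugacies keep the order of the intervals and change their lengths from
    \<open>l 0\<close> to \<open>l n\<close>.\<close>
  proof (intro exI[of _ "\<lambda>n. blowup (l 0) (l n) id"] conjI allI ballI)
    show "blowup (l 0) (l n) id \<in> Diff1_plus" for n
      by (rule blowup_Diff1[OF tame_change])
    fix g assume "g \<in> G"
    then obtain xs where g: "g = blowup (l 0) (l 0) (word xs)" by (auto simp: G_def \<Phi>_def)
    \<comment> \<open>Blow-ups compose, so conjugation merely replaces \<open>l 0\<close> by
      \<open>l n\<close> on both sides.\<close>
    have conj: "blowup (l 0) (l n) id \<circ> g \<circ> inv_into UNIV (blowup (l 0) (l n) id) = blowup (l n) (l n) (word xs)" for n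
    proof -
      have tame_back: "tame (l n) (l 0) id"
        using tame_inv[OF tame_change[of n]] by (simp only: inv_id)
      have "blowup (l 0) (l n) id \<circ> blowup (l 0) (l 0) (word xs) = blowup (l 0) (l n) (word xs)"
        using blowup_comp[OF tame_word tame_change] by simp
      moreover have "tame (l 0) (l n) (word xs)"
        using tame_comp[OF tame_word tame_change] by simp
      ultimately show ?thesis
        unfolding g inv_blowup[OF tame_change] inv_id
        using blowup_comp[OF tame_back, of "l n" "word xs"] by simp
    qed
    show "C1_tendsto (\<lambda>n. blowup (l 0) (l n) id \<circ> g \<circ> inv_into UNIV (blowup (l 0) (l n) id)) id"
      unfolding C1_tendsto_def conj
    proof (intro allI impI)
      fix e :: real assume e: "e > 0"
      \<comment> \<open>Squaring a ratio within \<open>d\<close> of 1 costs a factor 3, and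
        \<open>3 * d\<close> is at most \<open>e / 2\<close>, which leaves room for strict
        inequalities.\<close>
      define d where "d = min 1 (e / 6)"
      have d: "d > 0" "d \<le> 1" "3 * d < e" using e by (auto simp: d_def)
      show "\<forall>\<^sub>F n in sequentially. \<forall>x\<in>{0..1}. \<bar>blowup (l n) (l n) (word xs) x - id x\<bar> < e \<and>
          \<bar>D01 (blowup (l n) (l n) (word xs)) x - D01 id x\<bar> < e"
        using word_uniformly_close[OF lengths close d(1), of xs]
      proof eventually_elim
        case (elim n)
        have sq: "\<bar>(l n (word xs v) / l n v)\<^sup>2 - 1\<bar> \<le> 3 * d" for v
          using near_one_mult[OF d(2), of "l n (word xs v) / l n v" "l n (word xs v) / l n v"] elim
          by (simp add: power2_eq_square less_imp_le)
        show ?case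
        proof
          fix x :: real assume x: "x \<in> {0..1}"
          have "D01 id x = 1"
            using D01_eq[OF x, of id 1] by (simp add: id_def)
          then show "\<bar>blowup (l n) (l n) (word xs) x - id x\<bar> < e \<and>
              \<bar>D01 (blowup (l n) (l n) (word xs)) x - D01 id x\<bar> < e"
            using blowup_C1_close[OF tame_word _ sq x] d by (auto intro: order_le_less_trans)
        qed
      qed
    qed
  qed
  moreover have "diff_group G \<cong> F2"
  proof -
    let ?R = "{xs. reduced xs}"
    define \<Psi> where "\<Psi> = inv_into ?R \<Phi>"
    have bij: "bij_betw \<Psi> G ?R"
      unfolding \<Psi>_def G_red using \<Phi>_inj by (intro bij_betw_inv_into bij_betw_imageI) auto
    have \<Psi>: "\<Psi> f \<in> ?R" "\<Phi> (\<Psi> f) = f" if "f \<in> G" for f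
      using that inv_into_into[of f \<Phi> ?R] f_inv_into_f[of f \<Phi> ?R] unfolding \<Psi>_def G_red by auto
    have "\<Psi> (f \<circ> g) = red (\<Psi> f @ \<Psi> g)" if "f \<in> G" "g \<in> G" for f g
    proof -
      \<comment> \<open>This reduced word represents the product, and by injectivity of
        \<open>\<Phi>\<close> no other reduced word does.\<close>
      have "\<Phi> (red (\<Psi> f @ \<Psi> g)) = f \<circ> g"
        using \<Psi> that by (simp add: \<Phi>_red \<Phi>_append)
      then show ?thesis
        unfolding \<Psi>_def using inv_into_f_f[OF \<Phi>_inj, of "red (\<Psi> f @ \<Psi> g)"] reduced_red
        by (metis \<Psi>_def mem_Collect_eq)
    qed
    then have "\<Psi> \<in> iso (diff_group G) F2"
      using bij \<Psi>(1) by (auto simp: iso_def hom_def diff_group_def F2_def)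
    then show ?thesis by (rule is_isoI)
  qed
  ultimately show ?thesis by blast
qed

end
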